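(* Let $R$ be a commutative Noetherian ring with identity, $M$ a finitely generated $R$-module and $\mathfrak{a}$ an ideal of $R$ with $M\neq\mathfrak{a}M$ and $\operatorname{ara}(\mathfrak{a},M)=\operatorname{cd}(\mathfrak{a},M)$. Consider the following conditions: (i) $M$ is $\mathfrak{a}$-relative Cohen-Macaulay. (ii) Every $\mathfrak{a}$-relative system of parameters of $M$ is an $M$-regular sequence. (iii) There exists an $\mathfrak{a}$-relative system of parameters of $M$ which is an $M$-regular sequence. Then (i) and (iii) are equivalent. Furthermore, if $\mathfrak{a}$ is contained in the Jacobson radical of $R$, then all three conditions are equivalent.
   Context: All rings are commutative Noetherian with identity (not necessarily local). For an ideal $\mathfrak{a}$ of $R$ and a finitely generated $R$-module $M$, $\mathrm{H}^i_{\mathfrak{a}}(M)=\varinjlim_n \operatorname{Ext}^i_R(R/\mathfrak{a}^n,M)$ is the $i$-th local cohomology module, and $\operatorname{cd}(\mathfrak{a},M)$ is the supremum of the integers $i$ with $\mathrm{H}^i_{\mathfrak{a}}(M)\neq 0$. $\operatorname{Rad}$ denotes the radical of an ideal and $\operatorname{Ann}_R M$ the annihilator of $M$. Assume $M\neq\mathfrak{a}M$. The arithmetic rank $\operatorname{ara}(\mathfrak{a},M)$ of $\mathfrak{a}$ with respect to $M$ is the infimum of the integers $n\geq 0$ such that there exist $x_1,\ldots,x_n\in R$ with $\operatorname{Rad}(\langle x_1,\ldots,x_n\rangle+\operatorname{Ann}_R M)=\operatorname{Rad}(\mathfrak{a}+\operatorname{Ann}_R M)$. With $c=\operatorname{cd}(\mathfrak{a},M)$,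 a sequence $x_1,\ldots,x_c\in\mathfrak{a}$ (of length exactly $c$) is called an $\mathfrak{a}$-relative system of parameters of $M$ if $\operatorname{Rad}(\langle x_1,\ldots,x_c\rangle+\operatorname{Ann}_R M)=\operatorname{Rad}(\mathfrak{a}+\operatorname{Ann}_R M)$. The module $M$ (with $M\neq\mathfrak{a}M$) is called $\mathfrak{a}$-relative Cohen-Macaulay if $\operatorname{grade}(\mathfrak{a},M)=\operatorname{cd}(\mathfrak{a},M)$, where $\operatorname{grade}(\mathfrak{a},M)$ is the common length of maximal $M$-regular sequences contained in $\mathfrak{a}$. *)

theory Defs
  imports "HOL-Library.Extended_Real" "HOL-Algebra.Algebra"
begin

text \<open>
  Modules are those of \<^theory>\<open>HOL-Algebra.Module\<close>. Their record type inherits the fields \<open>mult\<close>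
  and \<open>one\<close> from rings; these play no role for modules and are left \<open>undefined\<close> below.
\<close>

section \<open>Modules\<close>

definition mod_span :: "('a, 'r) ring_scheme \<Rightarrow> ('a, 'b, 's) module_scheme \<Rightarrow> 'b set \<Rightarrow> 'b set"
  where "mod_span R M S = \<Inter>{N. submodule N R M \<and> S \<subseteq> N}"

definition fin_gen :: "('a, 'r) ring_scheme \<Rightarrow> ('a, 'b, 's) module_scheme \<Rightarrow> bool"
  where "fin_gen R M \<longleftrightarrow> (\<exists>S. finite S \<and> S \<subseteq> carrier M \<and> mod_span R M S = carrier M)"

definition ideal_smult :: "('a, 'r) ring_scheme \<Rightarrow> 'a set \<Rightarrow> ('a, 'b, 's) module_scheme \<Rightarrow> 'b set"
  where "ideal_smult R I M = mod_span R M {r \<odot>\<^bsub>M\<^esub> x | r x. r \<in> I \<and> x \<in> carrier M}"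

definition Ann :: "('a, 'r) ring_scheme \<Rightarrow> ('a, 'b, 's) module_scheme \<Rightarrow> 'a set"
  where "Ann R M = {r \<in> carrier R. \<forall>x \<in> carrier M. r \<odot>\<^bsub>M\<^esub> x = \<zero>\<^bsub>M\<^esub>}"

definition mod_quot :: "('a, 'b, 's) module_scheme \<Rightarrow> 'b set \<Rightarrow> ('a, 'b set) module"
  where "mod_quot M N =
    \<lparr>carrier = a_rcosets\<^bsub>M\<^esub> N, monoid.mult = undefined, monoid.one = undefined, ring.zero = N,
     ring.add = set_add M, smult = (\<lambda>r C. \<Union>x\<in>C. N +>\<^bsub>M\<^esub> (r \<odot>\<^bsub>M\<^esub> x))\<rparr>"

definition self_module :: "('a, 'r) ring_scheme \<Rightarrow> ('a, 'a) module"
  where "self_module R =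
    \<lparr>carrier = carrier R, monoid.mult = monoid.mult R, monoid.one = \<one>\<^bsub>R\<^esub>,
     ring.zero = \<zero>\<^bsub>R\<^esub>, ring.add = ring.add R, smult = monoid.mult R\<rparr>"

text \<open>\<open>R\<^sup>n\<close>, with coordinates indexed by \<open>{..<n}\<close>.\<close>

definition free_module :: "('a, 'r) ring_scheme \<Rightarrow> nat \<Rightarrow> ('a, nat \<Rightarrow> 'a) module"
  where "free_module R n =
    \<lparr>carrier = {..<n} \<rightarrow>\<^sub>E carrier R, monoid.mult = undefined, monoid.one = undefined,
     ring.zero = (\<lambda>i\<in>{..<n}. \<zero>\<^bsub>R\<^esub>), ring.add = (\<lambda>u v. \<lambda>i\<in>{..<n}. u i \<oplus>\<^bsub>R\<^esub> v i),
     smult = (\<lambda>r u. \<lambda>i\<in>{..<n}. r \<otimes>\<^bsub>R\<^esub> u i)\<rparr>"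

text \<open>Linear maps are taken extensional, so that equality of maps is equality on the carrier.\<close>

definition lin_maps ::
    "('a, 'r) ring_scheme \<Rightarrow> ('a, 'b, 's) module_scheme \<Rightarrow> ('a, 'c, 't) module_scheme \<Rightarrow> ('b \<Rightarrow> 'c) set"
  where "lin_maps R A B = {f \<in> carrier A \<rightarrow>\<^sub>E carrier B.
    (\<forall>x \<in> carrier A. \<forall>y \<in> carrier A. f (x \<oplus>\<^bsub>A\<^esub> y) = f x \<oplus>\<^bsub>B\<^esub> f y) \<and>
    (\<forall>r \<in> carrier R. \<forall>x \<in> carrier A. f (r \<odot>\<^bsub>A\<^esub> x) = r \<odot>\<^bsub>B\<^esub> f x)}"

definition Hom_module ::
    "('a, 'r) ring_scheme \<Rightarrow> ('a, 'b, 's) module_scheme \<Rightarrow> ('a, 'c, 't) module_scheme \<Rightarrow> ('a, 'b \<Rightarrow> 'c) module"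
  where "Hom_module R A B =
    \<lparr>carrier = lin_maps R A B, monoid.mult = undefined, monoid.one = undefined,
     ring.zero = (\<lambda>x\<in>carrier A. \<zero>\<^bsub>B\<^esub>), ring.add = (\<lambda>f g. \<lambda>x\<in>carrier A. f x \<oplus>\<^bsub>B\<^esub> g x),
     smult = (\<lambda>r f. \<lambda>x\<in>carrier A. r \<odot>\<^bsub>B\<^esub> f x)\<rparr>"


section \<open>Ext\<close>

text \<open>
  Resolutions \<open>\<dots> \<rightarrow> F\<^sub>2 \<rightarrow> F\<^sub>1 \<rightarrow> F\<^sub>0 \<rightarrow> N \<rightarrow> 0\<close> by free modules of finite rank, which exist for every
  finitely generated module over a Noetherian ring. Here \<open>F\<^sub>i\<close> is \<open>res_mod R P i\<close>,
  \<open>bd P i : F\<^sub>i\<^sub>+\<^sub>1 \<rightarrow> F\<^sub>i\<close> and \<open>aug P : F\<^sub>0 \<rightarrow> N\<close>.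
\<close>

record ('a, 'b) resolution =
  rk :: "nat \<Rightarrow> nat"
  bd :: "nat \<Rightarrow> (nat \<Rightarrow> 'a) \<Rightarrow> nat \<Rightarrow> 'a"
  aug :: "(nat \<Rightarrow> 'a) \<Rightarrow> 'b"

definition res_mod :: "('a, 'r) ring_scheme \<Rightarrow> ('a, 'b) resolution \<Rightarrow> nat \<Rightarrow> ('a, nat \<Rightarrow> 'a) module"
  where "res_mod R P i = free_module R (rk P i)"

definition free_resolution ::
    "('a, 'r) ring_scheme \<Rightarrow> ('a, 'b, 's) module_scheme \<Rightarrow> ('a, 'b) resolution \<Rightarrow> bool"
  where "free_resolution R N P \<longleftrightarrow>
    aug P \<in> lin_maps R (res_mod R P 0) N \<and>
    (\<forall>i. bd P i \<in> lin_maps R (res_mod R P (Suc i)) (res_mod R P i)) \<and>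
    aug P ` carrier (res_mod R P 0) = carrier N \<and>
    bd P 0 ` carrier (res_mod R P 1) = {x \<in> carrier (res_mod R P 0). aug P x = \<zero>\<^bsub>N\<^esub>} \<and>
    (\<forall>i. bd P (Suc i) ` carrier (res_mod R P (Suc (Suc i))) =
         {x \<in> carrier (res_mod R P (Suc i)). bd P i x = \<zero>\<^bsub>res_mod R P i\<^esub>})"

definition chosen_res ::
    "('a, 'r) ring_scheme \<Rightarrow> ('a, 'b, 's) module_scheme \<Rightarrow> ('a, 'b) resolution"
  where "chosen_res R N = (SOME P. free_resolution R N P)"

definition cocycles ::
    "('a, 'r) ring_scheme \<Rightarrow> ('a, 'b) resolution \<Rightarrow> ('a, 'c, 't) module_scheme \<Rightarrow> nat \<Rightarrow> ((nat \<Rightarrow> 'a) \<Rightarrow> 'c) set"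
  where "cocycles R P M i = {g \<in> lin_maps R (res_mod R P i) M.
    \<forall>x \<in> carrier (res_mod R P (Suc i)). g (bd P i x) = \<zero>\<^bsub>M\<^esub>}"

definition coboundaries ::
    "('a, 'r) ring_scheme \<Rightarrow> ('a, 'b) resolution \<Rightarrow> ('a, 'c, 't) module_scheme \<Rightarrow> nat \<Rightarrow> ((nat \<Rightarrow> 'a) \<Rightarrow> 'c) set"
  where "coboundaries R P M i = (case i of
      0 \<Rightarrow> {\<lambda>x\<in>carrier (res_mod R P 0). \<zero>\<^bsub>M\<^esub>}
    | Suc j \<Rightarrow> (\<lambda>g. \<lambda>x\<in>carrier (res_mod R P (Suc j)). g (bd P j x)) ` lin_maps R (res_mod R P j) M)"

definition cohomology ::
    "('a, 'r) ring_scheme \<Rightarrow> ('a, 'b) resolution \<Rightarrow> ('a, 'c, 't) module_scheme \<Rightarrow> nat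
      \<Rightarrow> ('a, ((nat \<Rightarrow> 'a) \<Rightarrow> 'c) set) module"
  where "cohomology R P M i =
    mod_quot ((Hom_module R (res_mod R P i) M)\<lparr>carrier := cocycles R P M i\<rparr>) (coboundaries R P M i)"

text \<open>
  \<open>Ext\<^sup>i(N, M)\<close> for finitely generated \<open>N\<close>, computed from a chosen resolution of \<open>N\<close>; up to
  isomorphism it does not depend on the choice.
\<close>

definition Ext ::
    "('a, 'r) ring_scheme \<Rightarrow> ('a, 'b, 's) module_scheme \<Rightarrow> ('a, 'c, 't) module_scheme \<Rightarrow> nat
      \<Rightarrow> ('a, ((nat \<Rightarrow> 'a) \<Rightarrow> 'c) set) module"
  where "Ext R N M i = cohomology R (chosen_res R N) M i"

definition chain_lift ::
    "('a, 'r) ring_scheme \<Rightarrow> ('a, 'b) resolution \<Rightarrow> ('a, 'c) resolution \<Rightarrow> ('b \<Rightarrow> 'c)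
      \<Rightarrow> (nat \<Rightarrow> (nat \<Rightarrow> 'a) \<Rightarrow> nat \<Rightarrow> 'a) \<Rightarrow> bool"
  where "chain_lift R P P' \<phi> f \<longleftrightarrow>
    (\<forall>i. f i \<in> lin_maps R (res_mod R P i) (res_mod R P' i)) \<and>
    (\<forall>x \<in> carrier (res_mod R P 0). aug P' (f 0 x) = \<phi> (aug P x)) \<and>
    (\<forall>i. \<forall>x \<in> carrier (res_mod R P (Suc i)). bd P' i (f (Suc i) x) = f i (bd P i x))"

text \<open>
  For \<open>\<phi> : N \<rightarrow> N'\<close>, the map \<open>Ext\<^sup>i(N', M) \<rightarrow> Ext\<^sup>i(N, M)\<close> given by precomposition with a lift of \<open>\<phi>\<close>
  to the chosen resolutions. Any two lifts are chain homotopic and hence induce the same map.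
\<close>

definition Ext_map ::
    "('a, 'r) ring_scheme \<Rightarrow> ('a, 'b, 's) module_scheme \<Rightarrow> ('a, 'c, 't) module_scheme \<Rightarrow> ('b \<Rightarrow> 'c)
      \<Rightarrow> ('a, 'd, 'u) module_scheme \<Rightarrow> nat \<Rightarrow> ((nat \<Rightarrow> 'a) \<Rightarrow> 'd) set \<Rightarrow> ((nat \<Rightarrow> 'a) \<Rightarrow> 'd) set"
  where "Ext_map R N N' \<phi> M i C =
    (let P = chosen_res R N; P' = chosen_res R N'; f = (SOME f. chain_lift R P P' \<phi> f)
     in \<Union>g\<in>C. coboundaries R P M i +>\<^bsub>Hom_module R (res_mod R P i) M\<^esub>
                 (\<lambda>x\<in>carrier (res_mod R P i). g (f i x)))"


section \<open>Local cohomology\<close>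

text \<open>Direct limit of modules \<open>E n\<close> with transition maps \<open>\<tau> n m : E n \<rightarrow> E m\<close> for \<open>n \<le> m\<close>.\<close>

definition dirlim_rel ::
    "(nat \<Rightarrow> ('a, 'b, 's) module_scheme) \<Rightarrow> (nat \<Rightarrow> nat \<Rightarrow> 'b \<Rightarrow> 'b) \<Rightarrow> ((nat \<times> 'b) \<times> (nat \<times> 'b)) set"
  where "dirlim_rel E \<tau> = {((n, x), (m, y)) | n x m y.
    x \<in> carrier (E n) \<and> y \<in> carrier (E m) \<and> (\<exists>k. n \<le> k \<and> m \<le> k \<and> \<tau> n k x = \<tau> m k y)}"

definition dirlim ::
    "(nat \<Rightarrow> ('a, 'b, 's) module_scheme) \<Rightarrow> (nat \<Rightarrow> nat \<Rightarrow> 'b \<Rightarrow> 'b) \<Rightarrow> ('a, (nat \<times> 'b) set) module"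
  where "dirlim E \<tau> =
    \<lparr>carrier = (SIGMA n : UNIV. carrier (E n)) // dirlim_rel E \<tau>,
     monoid.mult = undefined, monoid.one = undefined,
     ring.zero = dirlim_rel E \<tau> `` {(0, \<zero>\<^bsub>E 0\<^esub>)},
     ring.add = (\<lambda>C D. \<Union>{dirlim_rel E \<tau> `` {(k, \<tau> n k x \<oplus>\<^bsub>E k\<^esub> \<tau> m k y)} | n x m y k.
              (n, x) \<in> C \<and> (m, y) \<in> D \<and> n \<le> k \<and> m \<le> k}),
     smult = (\<lambda>r C. \<Union>(n, x)\<in>C. dirlim_rel E \<tau> `` {(n, r \<odot>\<^bsub>E n\<^esub> x)})\<rparr>"

definition ideal_power :: "('a, 'r) ring_scheme \<Rightarrow> 'a set \<Rightarrow> nat \<Rightarrow> 'a set"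
  where "ideal_power R I n = I [^]\<^bsub>ideals_set R\<^esub> n"

definition power_quot :: "('a, 'r) ring_scheme \<Rightarrow> 'a set \<Rightarrow> nat \<Rightarrow> ('a, 'a set) module"
  where "power_quot R I n = mod_quot (self_module R) (ideal_power R I n)"

text \<open>The projection \<open>R/I\<^sup>m \<rightarrow> R/I\<^sup>n\<close> for \<open>n \<le> m\<close> sends a coset \<open>C\<close> of \<open>I\<^sup>m\<close> to \<open>I\<^sup>n + C\<close>.\<close>

definition local_cohomology ::
    "('a, 'r) ring_scheme \<Rightarrow> 'a set \<Rightarrow> ('a, 'b, 's) module_scheme \<Rightarrow> nat
      \<Rightarrow> ('a, (nat \<times> ((nat \<Rightarrow> 'a) \<Rightarrow> 'b) set) set) module"
  where "local_cohomology R I M i =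
    dirlim (\<lambda>n. Ext R (power_quot R I n) M i)
      (\<lambda>n m. Ext_map R (power_quot R I m) (power_quot R I n) (\<lambda>C. ideal_power R I n <+>\<^bsub>R\<^esub> C) M i)"

text \<open>
  Ext and local cohomology vanish in negative degrees, so only degrees \<open>i :: nat\<close> matter.
  In the extended reals the supremum of the empty set is \<open>-\<infinity>\<close>.
\<close>

definition cd :: "('a, 'r) ring_scheme \<Rightarrow> 'a set \<Rightarrow> ('a, 'b, 's) module_scheme \<Rightarrow> ereal"
  where "cd R I M = Sup {ereal (real i) | i.
    carrier (local_cohomology R I M i) \<noteq> {\<zero>\<^bsub>local_cohomology R I M i\<^esub>}}"


section \<open>Arithmetic rank and relative systems of parameters\<close>

definition Rad :: "('a, 'r) ring_scheme \<Rightarrow> 'a set \<Rightarrow> 'a set"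
  where "Rad R I = {x \<in> carrier R. \<exists>n::nat. x [^]\<^bsub>R\<^esub> n \<in> I}"

definition jacobson_radical :: "('a, 'r) ring_scheme \<Rightarrow> 'a set"
  where "jacobson_radical R = {x \<in> carrier R. \<forall>J. maximalideal J R \<longrightarrow> x \<in> J}"

definition same_radical ::
    "('a, 'r) ring_scheme \<Rightarrow> 'a set \<Rightarrow> ('a, 'b, 's) module_scheme \<Rightarrow> 'a list \<Rightarrow> bool"
  where "same_radical R I M xs \<longleftrightarrow>
    Rad R (Idl\<^bsub>R\<^esub> (set xs) <+>\<^bsub>R\<^esub> Ann R M) = Rad R (I <+>\<^bsub>R\<^esub> Ann R M)"

definition ara :: "('a, 'r) ring_scheme \<Rightarrow> 'a set \<Rightarrow> ('a, 'b, 's) module_scheme \<Rightarrow> ereal"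
  where "ara R I M = Inf {ereal (real (length xs)) | xs. set xs \<subseteq> carrier R \<and> same_radical R I M xs}"

definition rel_sop :: "('a, 'r) ring_scheme \<Rightarrow> 'a set \<Rightarrow> ('a, 'b, 's) module_scheme \<Rightarrow> 'a list \<Rightarrow> bool"
  where "rel_sop R I M xs \<longleftrightarrow>
    set xs \<subseteq> I \<and> ereal (real (length xs)) = cd R I M \<and> same_radical R I M xs"


section \<open>Regular sequences, grade and relative Cohen-Macaulay modules\<close>

definition nonzerodivisor_on :: "('a, 'b, 's) module_scheme \<Rightarrow> 'a \<Rightarrow> bool"
  where "nonzerodivisor_on M r \<longleftrightarrow> (\<forall>x \<in> carrier M. r \<odot>\<^bsub>M\<^esub> x = \<zero>\<^bsub>M\<^esub> \<longrightarrow> x = \<zero>\<^bsub>M\<^esub>)"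

definition regular_seq :: "('a, 'r) ring_scheme \<Rightarrow> ('a, 'b, 's) module_scheme \<Rightarrow> 'a list \<Rightarrow> bool"
  where "regular_seq R M xs \<longleftrightarrow>
    set xs \<subseteq> carrier R \<and>
    (\<forall>i < length xs. nonzerodivisor_on (mod_quot M (ideal_smult R (Idl\<^bsub>R\<^esub> (set (take i xs))) M)) (xs ! i)) \<and>
    carrier M \<noteq> ideal_smult R (Idl\<^bsub>R\<^esub> (set xs)) M"

definition maximal_regular_seq ::
    "('a, 'r) ring_scheme \<Rightarrow> 'a set \<Rightarrow> ('a, 'b, 's) module_scheme \<Rightarrow> 'a list \<Rightarrow> bool"
  where "maximal_regular_seq R I M xs \<longleftrightarrow>
    set xs \<subseteq> I \<and> regular_seq R M xs \<and> \<not> (\<exists>y \<in> I. regular_seq R M (xs @ [y]))"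

definition grade :: "('a, 'r) ring_scheme \<Rightarrow> 'a set \<Rightarrow> ('a, 'b, 's) module_scheme \<Rightarrow> nat"
  where "grade R I M = (THE n. (\<exists>xs. maximal_regular_seq R I M xs) \<and>
    (\<forall>xs. maximal_regular_seq R I M xs \<longrightarrow> length xs = n))"

definition rel_cohen_macaulay :: "('a, 'r) ring_scheme \<Rightarrow> 'a set \<Rightarrow> ('a, 'b, 's) module_scheme \<Rightarrow> bool"
  where "rel_cohen_macaulay R I M \<longleftrightarrow>
    carrier M \<noteq> ideal_smult R I M \<and> ereal (real (grade R I M)) = cd R I M"

end

theory Submission
  imports Defs
begin

text \<open>
  Regular sequences on \<open>M\<close> are studied through submodules \<open>N\<close> of \<open>M\<close>, with \<open>M/N\<close> in the role of the
  successive quotients. Any \<open>c = cd(I, M) = ara(I, M)\<close> elements that generate \<open>I\<close> up to radical generate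
  an ideal of grade \<open>c\<close> once \<open>I\<close> has grade \<open>c\<close>. By prime avoidance such an ideal has a regular sequence
  of \<open>c\<close> generators, and in the Jacobson radical regular sequences may be permuted, so that the given
  generators are themselves regular. Conversely, a regular sequence that generates \<open>I\<close> up to radical is
  maximal, hence by the theorem of Rees computes the grade. Local cohomology enters only through the
  number \<open>c\<close>.
\<close>

section \<open>Ideals, prime avoidance and radicals\<close>

text \<open>The formal obstacle is that \<open>M\<close>, its quotients and the quotients of those
  live in different types (elements, cosets, cosets of cosets), so an induction along a sequence
  cannot run through actual quotient modules; submodules of one fixed \<open>M\<close> keep all
  stages in one type. The algebraic obstacle is that \<open>R\<close> need not be local and that
  Rees' theorem is usually read off from Ext. The only trace of Ext in the argument is
  \<open>kills J N\<close>, which for an ideal \<open>J\<close> says that Hom(R/J, M/N) is nonzero.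
  \<open>J\<close> contains a nonzerodivisor on \<open>M/N\<close> exactly when
  \<open>kills J N\<close> fails, and for weakly regular sequences \<open>xs\<close> in
  \<open>J\<close> the truth of \<open>kills J (ext N xs)\<close> depends on the length of
  \<open>xs\<close> alone. Grades of two ideals are therefore compared through what the ideals kill,
  and this does not change when an ideal is replaced by another with the same radical modulo the
  annihilator of \<open>M\<close>. The hypothesis \<open>ara = cd\<close> enters once, to supply a
  relative system of parameters.\<close>

context ring
begin

lemma ideal_add: "ideal J R \<Longrightarrow> x \<in> J \<Longrightarrow> y \<in> J \<Longrightarrow> x \<oplus> y \<in> J"
  and ideal_uminus: "ideal J R \<Longrightarrow> x \<in> J \<Longrightarrow> \<ominus> x \<in> J"
  and ideal_zero: "ideal J R \<Longrightarrow> \<zero> \<in> J"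
  by (simp_all add: additive_subgroup.a_closed additive_subgroup.a_inv_closed
      additive_subgroup.zero_closed ideal.axioms(1))

lemma ideal_add_cancel:
  assumes "ideal Q R" "a \<in> Q" "a \<oplus> b \<in> Q" "b \<in> carrier R"
  shows "b \<in> Q"
proof -
  have "a \<in> carrier R" using ideal.Icarr[OF assms(1,2)] .
  then have "(\<ominus> a) \<oplus> (a \<oplus> b) = b" using assms(4) by (simp add: r_neg1)
  then show ?thesis using ideal_add[OF assms(1) ideal_uminus[OF assms(1,2)] assms(3)] by simp
qed

end

context cring
begin

text \<open>Multiply an element of \<open>J\<close> outside \<open>P\<close> by one element outside
  \<open>P\<close> from each member of the family: the product lies in all these ideals, and
  primality keeps it out of \<open>P\<close>.\<close>

lemma prime_contains_Inter:
  assumes "finite \<A>" "\<And>A. A \<in> \<A> \<Longrightarrow> ideal A R" "primeideal P R" "\<And>A. A \<in> \<A> \<Longrightarrow> \<not> A \<subseteq> P"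
    and "ideal J R" "\<not> J \<subseteq> P"
  shows "\<exists>x\<in>J. (\<forall>A\<in>\<A>. x \<in> A) \<and> x \<notin> P"
  using assms(1,2,4)
proof (induction \<A> rule: finite_induct)
  case empty then show ?case using assms(6) by blast
next
  case (insert A \<A>)
  then obtain x where x: "x \<in> J" "\<forall>A\<in>\<A>. x \<in> A" "x \<notin> P" by auto
  obtain a where a: "a \<in> A" "a \<notin> P" using insert.prems(2) by blast
  have A: "ideal B R" if "B \<in> insert A \<A>" for B using insert.prems(1) that by simp
  have c: "a \<in> carrier R" "x \<in> carrier R"
    using ideal.Icarr A a(1) x(1) assms(5) by (metis insertI1)+
  have "x \<otimes> a \<in> J" using ideal.I_r_closed[OF assms(5)] x(1) c by blast
  moreover have "x \<otimes> a \<in> A" using ideal.I_l_closed[OF A] a(1) c by blast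
  moreover have "x \<otimes> a \<in> B" if "B \<in> \<A>" for B
    using ideal.I_r_closed[OF A] x(2) that c by blast
  moreover have "x \<otimes> a \<notin> P" using primeideal.I_prime[OF assms(3)] c a x by blast
  ultimately show ?case by blast
qed

text \<open>Removing a minimal prime \<open>P\<close> first allows the element
  found for the other primes to be corrected by an element of \<open>J\<close> that lies in all of them but not in \<open>P\<close>.\<close>

lemma coset_prime_avoidance:
  assumes "finite \<P>" "\<And>P. P \<in> \<P> \<Longrightarrow> primeideal P R" "ideal J R" "x \<in> carrier R"
    and "\<And>P. P \<in> \<P> \<Longrightarrow> \<not> insert x J \<subseteq> P"
  shows "\<exists>j\<in>J. \<forall>P\<in>\<P>. x \<oplus> j \<notin> P"
  using assms(1,2,5)
proof (induction "card \<P>" arbitrary: \<P>)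
  case 0
  then show ?case using ideal_zero[OF assms(3)] by auto
next
  case (Suc n)
  then obtain P where P: "P \<in> \<P>" "\<And>Q. Q \<in> \<P> \<Longrightarrow> Q \<subseteq> P \<Longrightarrow> Q = P"
    by (metis card_eq_0_iff finite_has_minimal nat.distinct(1))
  have "n = card (\<P> - {P})" using Suc.hyps(2) P(1) Suc.prems(1) by simp
  from Suc.hyps(1)[OF this] Suc.prems obtain j where j: "j \<in> J" "\<And>Q. Q \<in> \<P> - {P} \<Longrightarrow> x \<oplus> j \<notin> Q"
    by auto
  have prime: "primeideal Q R" if "Q \<in> \<P>" for Q using Suc.prems(2) that .
  then have id: "ideal Q R" if "Q \<in> \<P>" for Q using primeideal.axioms(1) that by blast
  have jc: "j \<in> carrier R" using ideal.Icarr[OF assms(3)] j(1) .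
  show ?case
  proof (cases "x \<oplus> j \<in> P")
    case False
    then show ?thesis using j by blast
  next
    case True
    have "\<not> J \<subseteq> P"
    proof
      assume J: "J \<subseteq> P"
      then have "x \<in> P"
        using ideal_add_cancel[OF id[OF P(1)], of j x] True j(1) assms(4) a_comm[OF jc] by auto
      then show False using J Suc.prems(3)[OF P(1)] by simp
    qed
    \<comment> \<open>Minimality of \<open>P\<close> is what guarantees that no other member of the
      family is contained in \<open>P\<close>.\<close>
    then obtain i where i: "i \<in> J" "\<forall>Q\<in>\<P> - {P}. i \<in> Q" "i \<notin> P"
      using prime_contains_Inter[of "\<P> - {P}" P J] Suc.prems(1) id prime[OF P(1)] P assms(3) by blast
    have ic: "i \<in> carrier R" using ideal.Icarr[OF assms(3)] i(1) .
    have eq: "x \<oplus> (j \<oplus> i) = i \<oplus> (x \<oplus> j)" "x \<oplus> (j \<oplus> i) = (x \<oplus> j) \<oplus> i"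
      using assms(4) jc ic by (simp_all add: a_ac)
    have "x \<oplus> (j \<oplus> i) \<notin> Q" if Q: "Q \<in> \<P>" for Q
    proof (cases "Q = P")
      case True
      then show ?thesis using ideal_add_cancel[OF id[OF P(1)] \<open>x \<oplus> j \<in> P\<close> _ ic] i(3) eq(2) by auto
    next
      case False
      then show ?thesis using ideal_add_cancel[OF id[OF Q], of i "x \<oplus> j"] i(2) j(2) Q eq(1) assms(4) jc by auto
    qed
    moreover have "j \<oplus> i \<in> J" using ideal_add[OF assms(3)] i(1) j(1) by blast
    ultimately show ?thesis by blast
  qed
qed

lemma Idl_insert_subset:
  assumes "J = Idl (insert x A)" "insert x A \<subseteq> carrier R"
  shows "ideal J R" "x \<in> J" "Idl A \<subseteq> J" "\<And>K. ideal K R \<Longrightarrow> x \<in> K \<Longrightarrow> A \<subseteq> K \<Longrightarrow> J \<subseteq> K"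
proof -
  show J: "ideal J R" unfolding assms(1) by (rule genideal_ideal[OF assms(2)])
  have "insert x A \<subseteq> J" unfolding assms(1) by (rule genideal_self[OF assms(2)])
  then show "x \<in> J" "Idl A \<subseteq> J" using genideal_minimal[OF J] by auto
  show "J \<subseteq> K" if "ideal K R" "x \<in> K" "A \<subseteq> K" for K
    unfolding assms(1) using genideal_minimal[OF that(1)] that(2,3) by simp
qed

text \<open>The multiplier \<open>r\<close> replaces the binomial theorem: a factor \<open>x\<close>
  or \<open>y\<close> split off the power is absorbed into \<open>r\<close>, which lowers
  \<open>m\<close> or \<open>n\<close> by one, until one of the two hypotheses says that
  \<open>r\<close> itself is in \<open>J\<close>.\<close>

lemma power_add_mem_ideal:
  fixes m n :: nat
  assumes J: "ideal J R" and c: "x \<in> carrier R" "y \<in> carrier R" "r \<in> carrier R"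
    and "r \<otimes> x [^] m \<in> J" "r \<otimes> y [^] n \<in> J"
  shows "r \<otimes> (x \<oplus> y) [^] (m + n) \<in> J"
  using assms(4-)
proof (induction "m + n" arbitrary: m n r rule: less_induct)
  case less
  note r = less.prems(1)
  consider "m = 0" | "n = 0" | m' n' where "m = Suc m'" "n = Suc n'" by (metis not0_implies_Suc)
  then show ?case
  proof cases
    case 1
    then show ?thesis using less.prems c ideal.I_r_closed[OF J, of r] by simp
  next
    case 2
    then show ?thesis using less.prems c ideal.I_r_closed[OF J, of r] by simp
  next
    case 3
    have x: "(r \<otimes> x) \<otimes> (x \<oplus> y) [^] (m' + n) \<in> J"
    proof (rule less.hyps)
      show "(r \<otimes> x) \<otimes> x [^] m' \<in> J"
        using less.prems(2) 3(1) r c by (simp add: m_ac)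
      have "x \<otimes> (r \<otimes> y [^] n) \<in> J" by (rule ideal.I_l_closed[OF J less.prems(3) c(1)])
      then show "(r \<otimes> x) \<otimes> y [^] n \<in> J" using r c by (simp add: m_ac)
    qed (use 3 r c in simp_all)
    have y: "(r \<otimes> y) \<otimes> (x \<oplus> y) [^] (m + n') \<in> J"
    proof (rule less.hyps)
      show "(r \<otimes> y) \<otimes> y [^] n' \<in> J"
        using less.prems(3) 3(2) r c by (simp add: m_ac)
      have "y \<otimes> (r \<otimes> x [^] m) \<in> J" by (rule ideal.I_l_closed[OF J less.prems(2) c(2)])
      then show "(r \<otimes> y) \<otimes> x [^] m \<in> J" using r c by (simp add: m_ac)
    qed (use 3 r c in simp_all)
    define p where "p = (x \<oplus> y) [^] (m + n')"
    have p: "p \<in> carrier R" using c by (simp add: p_def)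
    have "(x \<oplus> y) [^] (m' + n) = p" "(x \<oplus> y) [^] (m + n) = p \<otimes> (x \<oplus> y)"
      using 3 by (simp_all add: p_def)
    moreover have "r \<otimes> (p \<otimes> (x \<oplus> y)) = (r \<otimes> x) \<otimes> p \<oplus> (r \<otimes> y) \<otimes> p"
      using p r c by (simp add: r_distr m_ac)
    ultimately show ?thesis using ideal_add[OF J x y] p_def by simp
  qed
qed

lemma Rad_ideal:
  assumes J: "ideal J R"
  shows "ideal (Rad R J) R"
proof (rule idealI)
  show "ring R" by (rule ring_axioms)
  have l: "x \<otimes> a \<in> Rad R J" if "a \<in> Rad R J" "x \<in> carrier R" for a x
  proof -
    obtain n where n: "a \<in> carrier R" "a [^] (n::nat) \<in> J" using \<open>a \<in> Rad R J\<close> by (auto simp: Rad_def)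
    have "(x \<otimes> a) [^] n \<in> J"
      using ideal.I_l_closed[OF J n(2)] that(2) n(1) nat_pow_distrib[of x a n] by simp
    then show ?thesis using that(2) n(1) by (auto simp: Rad_def)
  qed
  show "x \<otimes> a \<in> Rad R J" if "a \<in> Rad R J" "x \<in> carrier R" for a x by (rule l[OF that])
  show "a \<otimes> x \<in> Rad R J" if "a \<in> Rad R J" "x \<in> carrier R" for a x
    using l[OF that] that m_comm by (simp add: Rad_def)
  show "subgroup (Rad R J) (add_monoid R)"
  proof (rule add.subgroupI)
    show "Rad R J \<subseteq> carrier R" by (auto simp: Rad_def)
    have "\<zero> [^] (1::nat) \<in> J" using ideal_zero[OF J] by simp
    then show "Rad R J \<noteq> {}" unfolding Rad_def using zero_closed by blast
    show "\<ominus> a \<in> Rad R J" if "a \<in> Rad R J" for a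
    proof -
      have "a \<in> carrier R" using that by (simp add: Rad_def)
      then show ?thesis using l[OF that, of "\<ominus> \<one>"] by (simp add: l_minus)
    qed
    show "a \<oplus> b \<in> Rad R J" if ab: "a \<in> Rad R J" "b \<in> Rad R J" for a b
    proof -
      obtain m n where "a \<in> carrier R" "a [^] (m::nat) \<in> J" "b \<in> carrier R" "b [^] (n::nat) \<in> J"
        using ab by (auto simp: Rad_def)
      then have "a \<oplus> b \<in> carrier R" "(a \<oplus> b) [^] (m + n) \<in> J"
        using power_add_mem_ideal[OF J, of a b \<one> m n] by simp_all
      then show ?thesis unfolding Rad_def by blast
    qed
  qed
qed

lemma Rad_mono: "J \<subseteq> K \<Longrightarrow> Rad R J \<subseteq> Rad R K"
  unfolding Rad_def by blast

lemma subset_Rad: "ideal J R \<Longrightarrow> J \<subseteq> Rad R J"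
  using ideal.Icarr nat_pow_eone by (fastforce simp: Rad_def intro: exI[of _ "1::nat"])

lemma Rad_subset_iff:
  assumes J: "ideal J R" and K: "ideal K R"
  shows "Rad R J \<subseteq> Rad R K \<longleftrightarrow> J \<subseteq> Rad R K"
proof
  assume "J \<subseteq> Rad R K"
  then show "Rad R J \<subseteq> Rad R K"
  proof (intro subsetI)
    fix x assume sub: "J \<subseteq> Rad R K" and "x \<in> Rad R J"
    then obtain n m where "x \<in> carrier R" "(x [^] (n::nat)) [^] (m::nat) \<in> K" by (fastforce simp: Rad_def)
    then show "x \<in> Rad R K" using nat_pow_pow[of x n m] by (auto simp: Rad_def)
  qed
qed (use subset_Rad[OF J] in blast)

lemma set_add_superset:
  assumes J: "ideal J R" and K: "ideal K R"
  shows "J \<subseteq> J <+>\<^bsub>R\<^esub> K" "K \<subseteq> J <+>\<^bsub>R\<^esub> K"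
proof -
  have "x = x \<oplus> \<zero>" if "x \<in> J" for x using ideal.Icarr[OF J that] by simp
  then show "J \<subseteq> J <+>\<^bsub>R\<^esub> K" using ideal_zero[OF K] unfolding set_add_def' by blast
  have "x = \<zero> \<oplus> x" if "x \<in> K" for x using ideal.Icarr[OF K that] by simp
  then show "K \<subseteq> J <+>\<^bsub>R\<^esub> K" using ideal_zero[OF J] unfolding set_add_def' by blast
qed

lemma set_add_least:
  assumes "ideal L R" "J \<subseteq> L" "K \<subseteq> L" shows "J <+>\<^bsub>R\<^esub> K \<subseteq> L"
  unfolding set_add_def' using ideal_add[OF assms(1)] assms(2,3) by blast

end

section \<open>Ascending chain conditions\<close>

text \<open>The union of a nonempty chain of ideals is a member of the chain, so Zorn's lemma
  applies to any nonempty family of ideals, whatever its closure properties.\<close>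

lemma (in noetherian_ring) maximal_ideal_in_family:
  assumes "\<F> \<noteq> {}" "\<And>J. J \<in> \<F> \<Longrightarrow> ideal J R"
  shows "\<exists>J\<in>\<F>. \<forall>K\<in>\<F>. J \<subseteq> K \<longrightarrow> K = J"
proof (rule subset_Zorn_nonempty[OF assms(1)])
  fix C assume C: "C \<noteq> {}" "subset.chain \<F> C"
  have "subset.chain {J. ideal J R} C"
    using C(2) assms(2) unfolding subset.chain_def by blast
  from ideal_chain_is_trivial[OF C(1) this] C(2) show "\<Union>C \<in> \<F>"
    unfolding subset.chain_def by blast
qed

text \<open>A proper ideal containing \<open>1 - a r\<close> would lie in a maximal ideal, which
  also contains \<open>a\<close> and hence 1. In Nakayama's lemma \<open>J\<close> is the
  annihilator of a class modulo a submodule.\<close>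

lemma (in noetherian_ring) jacobson_one_minus:
  assumes a: "a \<in> jacobson_radical R" and r: "r \<in> carrier R"
    and J: "ideal J R" "\<one> \<ominus> a \<otimes> r \<in> J"
  shows "\<one> \<in> J"
proof (rule ccontr)
  assume no: "\<one> \<notin> J"
  let ?F = "{K. ideal K R \<and> J \<subseteq> K \<and> \<one> \<notin> K}"
  have "\<exists>P\<in>?F. \<forall>K\<in>?F. P \<subseteq> K \<longrightarrow> K = P"
  proof (rule maximal_ideal_in_family)
    show "?F \<noteq> {}" using J(1) no by blast
  qed simp
  then obtain P where P: "P \<in> ?F" "\<forall>K\<in>?F. P \<subseteq> K \<longrightarrow> K = P" by (rule bexE)
  have ac: "a \<in> carrier R" using a by (simp add: jacobson_radical_def)
  have id: "ideal P R" using P(1) by simp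
  have "maximalideal P R"
  proof (rule maximalidealI)
    show "ideal P R" by (rule id)
    show "carrier R \<noteq> P" using P(1) by auto
    show "K = P \<or> K = carrier R" if K: "ideal K R" "P \<subseteq> K" "K \<subseteq> carrier R" for K
    proof (cases "\<one> \<in> K")
      case True
      then show ?thesis using ideal.one_imp_carrier[OF K(1)] by simp
    next
      case False
      then have "K \<in> ?F" using K P(1) by auto
      then show ?thesis using P(2) K(2) by blast
    qed
  qed
  then have "a \<in> P" using a by (simp add: jacobson_radical_def)
  then have "a \<otimes> r \<in> P" by (rule ideal.I_r_closed[OF id _ r])
  moreover have "\<one> \<ominus> a \<otimes> r \<in> P" using J(2) P(1) by blast
  ultimately have "\<one> \<ominus> a \<otimes> r \<oplus> a \<otimes> r \<in> P" using ideal_add[OF id] by blast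
  moreover have "\<one> \<ominus> a \<otimes> r \<oplus> a \<otimes> r = \<one>" using ac r by (simp add: minus_eq a_assoc l_neg)
  ultimately show False using P(1) by simp
qed

section \<open>Submodules and congruences in place of quotient modules\<close>

locale fg_noetherian_module = module R M + N?: noetherian_ring R for R (structure) and M (structure) +
  assumes fin_gen: "fin_gen R M"
begin

abbreviation submod :: "'c set \<Rightarrow> bool"
  where "submod N \<equiv> submodule N R M"

lemma submod_subset: "submod N \<Longrightarrow> N \<subseteq> carrier M"
  and submod_add: "submod N \<Longrightarrow> x \<in> N \<Longrightarrow> y \<in> N \<Longrightarrow> x \<oplus>\<^bsub>M\<^esub> y \<in> N"
  and submod_uminus: "submod N \<Longrightarrow> x \<in> N \<Longrightarrow> \<ominus>\<^bsub>M\<^esub> x \<in> N"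
  and submod_smult: "submod N \<Longrightarrow> r \<in> carrier R \<Longrightarrow> x \<in> N \<Longrightarrow> r \<odot>\<^bsub>M\<^esub> x \<in> N"
  by (simp_all add: submoduleE)

lemma submod_zero: "submod N \<Longrightarrow> \<zero>\<^bsub>M\<^esub> \<in> N"
  using submodule.axioms(1) subgroup.one_closed by fastforce

lemma submod_mem: "submod N \<Longrightarrow> x \<in> N \<Longrightarrow> x \<in> carrier M"
  using submod_subset by blast

lemma smult_commute:
  assumes "a \<in> carrier R" "b \<in> carrier R" "x \<in> carrier M"
  shows "a \<odot>\<^bsub>M\<^esub> (b \<odot>\<^bsub>M\<^esub> x) = b \<odot>\<^bsub>M\<^esub> (a \<odot>\<^bsub>M\<^esub> x)"
  using assms by (metis R.m_comm smult_assoc1)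

text \<open>Stands in for equality in \<open>M/N\<close>. Both carrier conditions are part of it, so
  that a congruence brings its own typing facts along.\<close>

definition cong_mod :: "'c set \<Rightarrow> 'c \<Rightarrow> 'c \<Rightarrow> bool"
  where "cong_mod N x y \<longleftrightarrow> x \<in> carrier M \<and> y \<in> carrier M \<and> x \<ominus>\<^bsub>M\<^esub> y \<in> N"

lemma cong_mod_refl: "submod N \<Longrightarrow> x \<in> carrier M \<Longrightarrow> cong_mod N x x"
  by (simp add: cong_mod_def submod_zero a_minus_def M.r_neg)

lemma cong_mod_sym:
  assumes "submod N" "cong_mod N x y" shows "cong_mod N y x"
proof -
  have xy: "x \<in> carrier M" "y \<in> carrier M" "x \<ominus>\<^bsub>M\<^esub> y \<in> N"
    using assms by (auto simp: cong_mod_def)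
  have "\<ominus>\<^bsub>M\<^esub> (x \<ominus>\<^bsub>M\<^esub> y) = y \<ominus>\<^bsub>M\<^esub> x"
    using xy by (simp add: a_minus_def M.minus_add M.a_comm)
  then show ?thesis using submod_uminus[OF assms(1) xy(3)] xy by (simp add: cong_mod_def)
qed

lemma cong_mod_add:
  assumes "submod N" "cong_mod N x y" "cong_mod N x' y'"
  shows "cong_mod N (x \<oplus>\<^bsub>M\<^esub> x') (y \<oplus>\<^bsub>M\<^esub> y')"
proof -
  have c: "x \<in> carrier M" "y \<in> carrier M" "x' \<in> carrier M" "y' \<in> carrier M"
    "x \<ominus>\<^bsub>M\<^esub> y \<in> N" "x' \<ominus>\<^bsub>M\<^esub> y' \<in> N"
    using assms by (auto simp: cong_mod_def)
  have "(x \<oplus>\<^bsub>M\<^esub> x') \<ominus>\<^bsub>M\<^esub> (y \<oplus>\<^bsub>M\<^esub> y') = (x \<ominus>\<^bsub>M\<^esub> y) \<oplus>\<^bsub>M\<^esub> (x' \<ominus>\<^bsub>M\<^esub> y')"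
    using c by (simp add: a_minus_def M.minus_add M.a_ac)
  then show ?thesis using submod_add[OF assms(1) c(5,6)] c by (simp add: cong_mod_def)
qed

lemma cong_mod_trans:
  assumes "submod N" "cong_mod N x y" "cong_mod N y z"
  shows "cong_mod N x z"
proof -
  have c: "x \<in> carrier M" "y \<in> carrier M" "z \<in> carrier M" "x \<ominus>\<^bsub>M\<^esub> y \<in> N" "y \<ominus>\<^bsub>M\<^esub> z \<in> N"
    using assms by (auto simp: cong_mod_def)
  have "(x \<ominus>\<^bsub>M\<^esub> y) \<oplus>\<^bsub>M\<^esub> (y \<ominus>\<^bsub>M\<^esub> z) = x \<ominus>\<^bsub>M\<^esub> z"
    using c by (simp add: a_minus_def M.a_assoc M.r_neg1)
  then show ?thesis using submod_add[OF assms(1) c(4,5)] c by (simp add: cong_mod_def)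
qed

lemma cong_mod_smult:
  assumes "submod N" "cong_mod N x y" "a \<in> carrier R"
  shows "cong_mod N (a \<odot>\<^bsub>M\<^esub> x) (a \<odot>\<^bsub>M\<^esub> y)"
proof -
  have c: "x \<in> carrier M" "y \<in> carrier M" "x \<ominus>\<^bsub>M\<^esub> y \<in> N"
    using assms by (auto simp: cong_mod_def)
  have "a \<odot>\<^bsub>M\<^esub> (x \<ominus>\<^bsub>M\<^esub> y) = a \<odot>\<^bsub>M\<^esub> x \<ominus>\<^bsub>M\<^esub> a \<odot>\<^bsub>M\<^esub> y"
    using c assms(3) by (simp add: a_minus_def smult_r_distr smult_r_minus)
  then show ?thesis using submod_smult[OF assms(1,3) c(3)] c assms(3) by (simp add: cong_mod_def)
qed

lemma cong_mod_zero: "submod N \<Longrightarrow> cong_mod N x \<zero>\<^bsub>M\<^esub> \<longleftrightarrow> x \<in> N"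
proof -
  have "\<ominus>\<^bsub>M\<^esub> \<zero>\<^bsub>M\<^esub> = \<zero>\<^bsub>M\<^esub>" by (metis M.l_neg M.r_zero M.zero_closed M.add.inv_closed)
  then have "x \<ominus>\<^bsub>M\<^esub> \<zero>\<^bsub>M\<^esub> = x" if "x \<in> carrier M"
    using that by (simp only: a_minus_def M.r_zero)
  then show "submod N \<Longrightarrow> cong_mod N x \<zero>\<^bsub>M\<^esub> \<longleftrightarrow> x \<in> N"
    using submod_mem by (auto simp: cong_mod_def)
qed

lemma cong_mod_mem:
  assumes "submod N" "cong_mod N x y" shows "x \<in> N \<longleftrightarrow> y \<in> N"
  using assms by (metis cong_mod_sym cong_mod_trans cong_mod_zero)

lemma cong_mod_mono: "N \<subseteq> L \<Longrightarrow> cong_mod N x y \<Longrightarrow> cong_mod L x y"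
  by (auto simp: cong_mod_def)

text \<open>The submodule \<open>N + aM\<close>; a membership is a congruence modulo \<open>N\<close> with a multiple of \<open>a\<close>.\<close>

definition add_mult :: "'c set \<Rightarrow> 'a \<Rightarrow> 'c set"
  where "add_mult N a = {x. \<exists>v\<in>carrier M. cong_mod N x (a \<odot>\<^bsub>M\<^esub> v)}"

text \<open>The submodule \<open>N + Rm\<close>: the scalar varies and the vector is fixed, the
  reverse of \<open>add_mult\<close>.\<close>

definition add_gen :: "'c set \<Rightarrow> 'c \<Rightarrow> 'c set"
  where "add_gen N m = {x. \<exists>r\<in>carrier R. cong_mod N x (r \<odot>\<^bsub>M\<^esub> m)}"

lemma add_mult_submod:
  assumes N: "submod N" and a: "a \<in> carrier R"
  shows "submod (add_mult N a)"
proof (rule submoduleI)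
  show "add_mult N a \<subseteq> carrier M" by (auto simp: add_mult_def cong_mod_def)
  show "\<zero>\<^bsub>M\<^esub> \<in> add_mult N a"
    using cong_mod_refl[OF N M.zero_closed] a unfolding add_mult_def
    by (auto intro!: bexI[of _ "\<zero>\<^bsub>M\<^esub>"])
  show s: "r \<odot>\<^bsub>M\<^esub> x \<in> add_mult N a" if "r \<in> carrier R" "x \<in> add_mult N a" for r x
  proof -
    from that obtain v where v: "v \<in> carrier M" "cong_mod N x (a \<odot>\<^bsub>M\<^esub> v)" by (auto simp: add_mult_def)
    then have "cong_mod N (r \<odot>\<^bsub>M\<^esub> x) (a \<odot>\<^bsub>M\<^esub> (r \<odot>\<^bsub>M\<^esub> v))"
      using cong_mod_smult[OF N v(2) that(1)] smult_commute[OF that(1) a v(1)] by simp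
    then show ?thesis using v that by (auto simp: add_mult_def)
  qed
  show "\<ominus>\<^bsub>M\<^esub> x \<in> add_mult N a" if "x \<in> add_mult N a" for x
    using s[OF _ that, of "\<ominus>\<one>"] that by (simp add: smult_l_minus add_mult_def cong_mod_def)
  show "x \<oplus>\<^bsub>M\<^esub> y \<in> add_mult N a" if "x \<in> add_mult N a" "y \<in> add_mult N a" for x y
  proof -
    from that obtain v w where v: "v \<in> carrier M" "cong_mod N x (a \<odot>\<^bsub>M\<^esub> v)"
      "w \<in> carrier M" "cong_mod N y (a \<odot>\<^bsub>M\<^esub> w)" by (auto simp: add_mult_def)
    then have "cong_mod N (x \<oplus>\<^bsub>M\<^esub> y) (a \<odot>\<^bsub>M\<^esub> (v \<oplus>\<^bsub>M\<^esub> w))"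
      using cong_mod_add[OF N v(2,4)] a by (simp add: smult_r_distr)
    then show ?thesis using v that by (auto simp: add_mult_def)
  qed
qed

lemma add_gen_submod:
  assumes N: "submod N" and m: "m \<in> carrier M"
  shows "submod (add_gen N m)"
proof (rule submoduleI)
  show "add_gen N m \<subseteq> carrier M" by (auto simp: add_gen_def cong_mod_def)
  show "\<zero>\<^bsub>M\<^esub> \<in> add_gen N m"
    using cong_mod_refl[OF N M.zero_closed] m unfolding add_gen_def
    by (auto intro!: bexI[of _ "\<zero>"])
  show s: "r \<odot>\<^bsub>M\<^esub> x \<in> add_gen N m" if "r \<in> carrier R" "x \<in> add_gen N m" for r x
  proof -
    from that obtain v where v: "v \<in> carrier R" "cong_mod N x (v \<odot>\<^bsub>M\<^esub> m)" by (auto simp: add_gen_def)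
    then have "cong_mod N (r \<odot>\<^bsub>M\<^esub> x) ((r \<otimes> v) \<odot>\<^bsub>M\<^esub> m)"
      using cong_mod_smult[OF N v(2) that(1)] that m by (simp add: smult_assoc1)
    then show ?thesis using v that by (auto simp: add_gen_def)
  qed
  show "\<ominus>\<^bsub>M\<^esub> x \<in> add_gen N m" if "x \<in> add_gen N m" for x
    using s[OF _ that, of "\<ominus>\<one>"] that by (simp add: smult_l_minus add_gen_def cong_mod_def)
  show "x \<oplus>\<^bsub>M\<^esub> y \<in> add_gen N m" if "x \<in> add_gen N m" "y \<in> add_gen N m" for x y
  proof -
    from that obtain v w where v: "v \<in> carrier R" "cong_mod N x (v \<odot>\<^bsub>M\<^esub> m)"
      "w \<in> carrier R" "cong_mod N y (w \<odot>\<^bsub>M\<^esub> m)" by (auto simp: add_gen_def)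
    then have "cong_mod N (x \<oplus>\<^bsub>M\<^esub> y) ((v \<oplus> w) \<odot>\<^bsub>M\<^esub> m)"
      using cong_mod_add[OF N v(2,4)] m by (simp add: smult_l_distr)
    then show ?thesis using v that by (auto simp: add_gen_def)
  qed
qed

lemma add_mult_superset:
  assumes "submod N" "a \<in> carrier R" shows "N \<subseteq> add_mult N a"
proof
  fix x assume "x \<in> N"
  then have "cong_mod N x (a \<odot>\<^bsub>M\<^esub> \<zero>\<^bsub>M\<^esub>)" using assms cong_mod_zero by simp
  then show "x \<in> add_mult N a" by (auto simp: add_mult_def)
qed

lemma add_gen_superset:
  assumes "submod N" "m \<in> carrier M" shows "N \<subseteq> add_gen N m"
proof
  fix x assume "x \<in> N"
  then have "cong_mod N x (\<zero> \<odot>\<^bsub>M\<^esub> m)" using assms cong_mod_zero by simp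
  then show "x \<in> add_gen N m" by (auto simp: add_gen_def)
qed

lemma add_gen_self:
  assumes "submod N" "m \<in> carrier M" shows "m \<in> add_gen N m"
  using cong_mod_refl[OF assms] assms(2) by (auto simp: add_gen_def intro!: bexI[of _ \<one>])

lemma add_mult_mult:
  assumes "submod N" "a \<in> carrier R" "v \<in> carrier M" shows "a \<odot>\<^bsub>M\<^esub> v \<in> add_mult N a"
  using cong_mod_refl[OF assms(1) smult_closed[OF assms(2,3)]] assms(3)
  by (auto simp: add_mult_def intro: bexI[of _ v])

lemma add_mult_least:
  assumes N: "submod N" and L: "submod L" "N \<subseteq> L" "\<And>v. v \<in> carrier M \<Longrightarrow> a \<odot>\<^bsub>M\<^esub> v \<in> L"
  shows "add_mult N a \<subseteq> L"
  using cong_mod_mem[OF L(1)] cong_mod_mono[OF L(2)] L(3) by (fastforce simp: add_mult_def)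

text \<open>The annihilator of the class of \<open>u\<close> in \<open>M/N\<close>.\<close>

definition colon :: "'c set \<Rightarrow> 'c \<Rightarrow> 'a set"
  where "colon N u = {r \<in> carrier R. r \<odot>\<^bsub>M\<^esub> u \<in> N}"

lemma colon_ideal:
  assumes N: "submod N" and u: "u \<in> carrier M" shows "ideal (colon N u) R"
proof (rule idealI)
  show "ring R" by (rule R.ring_axioms)
  show "subgroup (colon N u) (add_monoid R)"
  proof (rule R.add.subgroupI)
    show "colon N u \<noteq> {}"
      using submod_zero[OF N] u by (auto simp: colon_def intro!: exI[of _ \<zero>])
    show "\<ominus> a \<in> colon N u" if "a \<in> colon N u" for a
      using that u submod_uminus[OF N] by (simp add: colon_def smult_l_minus)
    show "a \<oplus> b \<in> colon N u" if "a \<in> colon N u" "b \<in> colon N u" for a b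
      using that u submod_add[OF N] by (simp add: colon_def smult_l_distr)
  qed (auto simp: colon_def)
  show l: "x \<otimes> a \<in> colon N u" if "a \<in> colon N u" "x \<in> carrier R" for a x
    using that u submod_smult[OF N] by (simp add: colon_def smult_assoc1)
  show "a \<otimes> x \<in> colon N u" if "a \<in> colon N u" "x \<in> carrier R" for a x
    using l[OF that] that R.m_comm by (simp add: colon_def)
qed

section \<open>The ascending chain condition for submodules\<close>

lemma mod_span_mono: "S \<subseteq> T \<Longrightarrow> mod_span R M S \<subseteq> mod_span R M T"
  unfolding mod_span_def by blast

lemma mod_span_least: "submod N \<Longrightarrow> S \<subseteq> N \<Longrightarrow> mod_span R M S \<subseteq> N"
  unfolding mod_span_def by blast

lemma mod_span_superset: "S \<subseteq> mod_span R M S"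
  unfolding mod_span_def by blast

text \<open>Induction on a generating set \<open>S\<close> of \<open>M\<close> modulo \<open>B\<close>: for a submodule \<open>L\<close> above \<open>B\<close>, the pair
  \<open>(L + Rm, L : m)\<close> determines \<open>L\<close> within a chain.\<close>

lemma maximal_submod_above:
  assumes "finite S" "S \<subseteq> carrier M" "submod B" "mod_span R M (B \<union> S) = carrier M"
    and "\<F> \<noteq> {}" "\<And>L. L \<in> \<F> \<Longrightarrow> submod L \<and> B \<subseteq> L"
  shows "\<exists>L\<in>\<F>. \<forall>L'\<in>\<F>. L \<subseteq> L' \<longrightarrow> L' = L"
  using assms
proof (induction S arbitrary: B \<F> rule: finite_induct)
  case empty
  have "carrier M \<subseteq> B"
    using mod_span_least[OF empty.prems(2) order_refl] empty.prems(3) by (simp only: Un_empty_right)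
  moreover have "L \<subseteq> carrier M" "B \<subseteq> L" if "L \<in> \<F>" for L
    using empty.prems(5)[OF that] submod_subset by blast+
  moreover obtain L where "L \<in> \<F>" using empty.prems(4) by blast
  ultimately show ?case by (metis subset_antisym subset_trans)
next
  case (insert m S)
  then have m: "m \<in> carrier M" by simp
  let ?p = "\<lambda>L. add_gen L m"
  have F: "submod L" "B \<subseteq> L" if "L \<in> \<F>" for L using insert.prems(5)[OF that] by auto
  have mono: "?p L \<subseteq> ?p L'" if "L \<subseteq> L'" for L L'
    using that cong_mod_mono unfolding add_gen_def by blast
  have "mod_span R M (B \<union> insert m S) \<subseteq> mod_span R M (add_gen B m \<union> S)"
    using add_gen_superset[OF insert.prems(2) m] add_gen_self[OF insert.prems(2) m]
    by (intro mod_span_mono) auto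
  moreover have "mod_span R M (add_gen B m \<union> S) \<subseteq> carrier M"
    using insert.prems(1) submod_subset[OF add_gen_submod[OF insert.prems(2) m]]
    by (intro mod_span_least carrier_is_submodule) auto
  ultimately have span: "mod_span R M (add_gen B m \<union> S) = carrier M" using insert.prems(3) by auto
  have "\<exists>K\<in>?p ` \<F>. \<forall>K'\<in>?p ` \<F>. K \<subseteq> K' \<longrightarrow> K' = K"
  proof (rule insert.IH[OF _ _ span])
    show "submod K \<and> add_gen B m \<subseteq> K" if "K \<in> ?p ` \<F>" for K
      using that F mono add_gen_submod[OF _ m] by blast
  qed (use insert.prems add_gen_submod m in auto)
  then obtain L0 where L0: "L0 \<in> \<F>" "\<And>L'. L' \<in> \<F> \<Longrightarrow> ?p L0 \<subseteq> ?p L' \<Longrightarrow> ?p L' = ?p L0" by auto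
  \<comment> \<open>The induction hypothesis has maximised \<open>L + Rm\<close>. Among the
    maximisers, the Noetherian ring now maximises \<open>L : m\<close>.\<close>
  let ?G = "{L \<in> \<F>. ?p L = ?p L0}"
  have "\<exists>J\<in>(\<lambda>L. colon L m) ` ?G. \<forall>K\<in>(\<lambda>L. colon L m) ` ?G. J \<subseteq> K \<longrightarrow> K = J"
    by (rule N.maximal_ideal_in_family) (use L0 colon_ideal F m in auto)
  then obtain L1 where L1: "L1 \<in> \<F>" "?p L1 = ?p L0"
    "\<And>L'. L' \<in> \<F> \<Longrightarrow> ?p L' = ?p L0 \<Longrightarrow> colon L1 m \<subseteq> colon L' m \<Longrightarrow> colon L' m = colon L1 m" by auto
  have "L' = L1" if L': "L' \<in> \<F>" "L1 \<subseteq> L'" for L'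
  proof
    have p: "?p L' = ?p L0" using L0(2)[OF L'(1)] mono[OF L'(2)] L1(2) by simp
    have c: "colon L' m = colon L1 m" by (rule L1(3)[OF L'(1) p]) (use L' in \<open>auto simp: colon_def\<close>)
    show "L' \<subseteq> L1"
    proof
      fix x assume x: "x \<in> L'"
      then have "x \<in> ?p L1" using add_gen_superset[OF F(1)[OF L'(1)] m] p L1(2) by auto
      then obtain r where r: "r \<in> carrier R" "cong_mod L1 x (r \<odot>\<^bsub>M\<^esub> m)" by (auto simp: add_gen_def)
      then have "r \<odot>\<^bsub>M\<^esub> m \<in> L'"
        using cong_mod_mem[OF F(1)[OF L'(1)] cong_mod_mono[OF L'(2)]] x by blast
      then have "r \<in> colon L1 m" using c r by (auto simp: colon_def)
      then show "x \<in> L1" using cong_mod_mem[OF F(1)[OF L1(1)] r(2)] by (simp add: colon_def)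
    qed
  qed (rule L'(2))
  then show ?case using L1(1) by blast
qed

lemma zero_submod: "submod {\<zero>\<^bsub>M\<^esub>}"
  by (rule submoduleI) auto

lemma maximal_submod_in_family:
  assumes "\<F> \<noteq> {}" "\<And>L. L \<in> \<F> \<Longrightarrow> submod L"
  shows "\<exists>L\<in>\<F>. \<forall>L'\<in>\<F>. L \<subseteq> L' \<longrightarrow> L' = L"
proof -
  obtain S where S: "finite S" "S \<subseteq> carrier M" "mod_span R M S = carrier M"
    using fin_gen unfolding fin_gen_def by blast
  have "mod_span R M ({\<zero>\<^bsub>M\<^esub>} \<union> S) = carrier M"
    using mod_span_mono[of S "{\<zero>\<^bsub>M\<^esub>} \<union> S"] S
      mod_span_least[OF carrier_is_submodule, of "{\<zero>\<^bsub>M\<^esub>} \<union> S"] by auto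
  from maximal_submod_above[OF S(1,2) zero_submod this assms(1)] show ?thesis
    using assms(2) submod_zero by auto
qed

section \<open>Zero divisors\<close>

definition nzd :: "'c set \<Rightarrow> 'a \<Rightarrow> bool"
  where "nzd N r \<longleftrightarrow> (\<forall>x\<in>carrier M. r \<odot>\<^bsub>M\<^esub> x \<in> N \<longrightarrow> x \<in> N)"

text \<open>Some nonzero class of \<open>M/N\<close> is annihilated by all of \<open>J\<close>.
  Allowing any set \<open>J\<close>, not only an ideal, makes the notion available for
  \<open>insert x J\<close> in coset avoidance.\<close>

definition kills :: "'a set \<Rightarrow> 'c set \<Rightarrow> bool"
  where "kills J N \<longleftrightarrow> (\<exists>u\<in>carrier M - N. \<forall>r\<in>J. r \<odot>\<^bsub>M\<^esub> u \<in> N)"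

text \<open>The maximal annihilators of nonzero classes of \<open>M/N\<close>, that is, the maximal
  associated primes. Their union is the set of zero divisors on \<open>M/N\<close>, so they are the
  primes to avoid.\<close>

definition max_colons :: "'c set \<Rightarrow> 'a set set"
  where "max_colons N = {P \<in> colon N ` (carrier M - N). \<forall>Q\<in>colon N ` (carrier M - N). P \<subseteq> Q \<longrightarrow> Q = P}"

text \<open>If \<open>a b\<close> kills \<open>u\<close> but \<open>b\<close> does not, then the
  annihilator of \<open>b u\<close> contains \<open>a\<close> and the annihilator of
  \<open>u\<close>; by maximality the two annihilators agree.\<close>

lemma max_colons_prime:
  assumes N: "submod N" and P: "P \<in> max_colons N"
  shows "primeideal P R"
proof -
  obtain u where u: "u \<in> carrier M" "u \<notin> N" "P = colon N u" using P by (auto simp: max_colons_def)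
  have one: "\<one> \<notin> P" using u by (simp add: colon_def)
  show ?thesis
  proof (rule primeidealI)
    show "ideal P R" using colon_ideal[OF N u(1)] u(3) by simp
    show "cring R" by (rule R.cring_axioms)
    show "carrier R \<noteq> P" using one by auto
    show "a \<in> P \<or> b \<in> P" if ab: "a \<in> carrier R" "b \<in> carrier R" "a \<otimes> b \<in> P" for a b
    proof (rule disjCI)
      assume "b \<notin> P"
      then have b: "b \<odot>\<^bsub>M\<^esub> u \<in> carrier M - N" using u ab by (simp add: colon_def)
      have "P \<subseteq> colon N (b \<odot>\<^bsub>M\<^esub> u)"
        using u ab submod_smult[OF N ab(2)] smult_commute[OF _ ab(2) u(1)] by (auto simp: colon_def)
      then have "colon N (b \<odot>\<^bsub>M\<^esub> u) = P" using P b by (auto simp: max_colons_def)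
      moreover have "a \<in> colon N (b \<odot>\<^bsub>M\<^esub> u)"
        using ab u by (simp add: colon_def smult_assoc1)
      ultimately show "a \<in> P" by simp
    qed
  qed
qed

lemma max_colons_above:
  assumes N: "submod N" and u: "u \<in> carrier M - N"
  shows "\<exists>P\<in>max_colons N. colon N u \<subseteq> P"
proof -
  let ?F = "{Q \<in> colon N ` (carrier M - N). colon N u \<subseteq> Q}"
  have "\<exists>P\<in>?F. \<forall>Q\<in>?F. P \<subseteq> Q \<longrightarrow> Q = P"
  proof (rule N.maximal_ideal_in_family)
    show "?F \<noteq> {}" using u by blast
    show "ideal J R" if "J \<in> ?F" for J using that colon_ideal[OF N] by blast
  qed
  then obtain P where P: "P \<in> ?F" "\<forall>Q\<in>?F. P \<subseteq> Q \<longrightarrow> Q = P" by (rule bexE)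
  have "Q = P" if Q: "Q \<in> colon N ` (carrier M - N)" "P \<subseteq> Q" for Q
  proof -
    have "Q \<in> ?F" using P(1) Q by (simp add: subset_trans[of _ P])
    then show ?thesis using P(2) Q(2) by simp
  qed
  then have "P \<in> max_colons N" using P(1) by (simp add: max_colons_def)
  then show ?thesis using P(1) by blast
qed

text \<open>A maximal \<open>L\<close> in \<open>F\<close> contains all of \<open>U\<close>, so for
  one finite \<open>A\<close> whatever lies in every colon ideal of \<open>A\<close> kills all of
  \<open>U\<close> modulo \<open>N\<close>. A prime in \<open>max_colons N\<close> therefore
  contains one of these finitely many colon ideals, and equals it since both are maximal.\<close>

lemma finite_max_colons:
  assumes N: "submod N"
  shows "finite (max_colons N)"
proof -
  define U where "U = {u \<in> carrier M - N. colon N u \<in> max_colons N}"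
  define F where "F = {L. submod L \<and> N \<subseteq> L \<and> (\<exists>A. finite A \<and> A \<subseteq> U \<and>
    (\<forall>r\<in>carrier R. (\<forall>u\<in>A. r \<in> colon N u) \<longrightarrow> (\<forall>x\<in>L. r \<odot>\<^bsub>M\<^esub> x \<in> N)))}"
  have "N \<in> F" using N submod_smult[OF N] by (auto simp: F_def)
  then have "\<exists>L\<in>F. \<forall>L'\<in>F. L \<subseteq> L' \<longrightarrow> L' = L"
    by (intro maximal_submod_in_family) (blast, simp add: F_def)
  then obtain L where L: "L \<in> F" "\<And>L'. L' \<in> F \<Longrightarrow> L \<subseteq> L' \<Longrightarrow> L' = L" by blast
  from L(1) have "submod L \<and> N \<subseteq> L \<and> (\<exists>A. finite A \<and> A \<subseteq> U \<and>
    (\<forall>r\<in>carrier R. (\<forall>u\<in>A. r \<in> colon N u) \<longrightarrow> (\<forall>x\<in>L. r \<odot>\<^bsub>M\<^esub> x \<in> N)))"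
    by (simp only: F_def mem_Collect_eq)
  then obtain A where A: "submod L" "N \<subseteq> L" "finite A" "A \<subseteq> U"
    "\<And>r x. r \<in> carrier R \<Longrightarrow> \<forall>u\<in>A. r \<in> colon N u \<Longrightarrow> x \<in> L \<Longrightarrow> r \<odot>\<^bsub>M\<^esub> x \<in> N"
    by blast
  have U_L: "u \<in> L" if u: "u \<in> U" for u
  proof -
    have um: "u \<in> carrier M" using u by (simp add: U_def)
    have "r \<odot>\<^bsub>M\<^esub> x \<in> N" if r: "r \<in> carrier R" "\<forall>v\<in>insert u A. r \<in> colon N v"
      and x: "x \<in> add_gen L u" for r x
    proof -
      obtain s where s: "s \<in> carrier R" "cong_mod L x (s \<odot>\<^bsub>M\<^esub> u)" using x by (auto simp: add_gen_def)
      have xm: "x \<in> carrier M" using s by (simp add: cong_mod_def)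
      have "r \<odot>\<^bsub>M\<^esub> (x \<ominus>\<^bsub>M\<^esub> s \<odot>\<^bsub>M\<^esub> u) \<in> N" using A(5) r s by (simp add: cong_mod_def)
      then have "cong_mod N (r \<odot>\<^bsub>M\<^esub> x) (r \<odot>\<^bsub>M\<^esub> (s \<odot>\<^bsub>M\<^esub> u))"
        using r(1) s(1) um xm by (simp add: cong_mod_def a_minus_def smult_r_distr smult_r_minus)
      moreover have "r \<odot>\<^bsub>M\<^esub> (s \<odot>\<^bsub>M\<^esub> u) \<in> N"
        using smult_commute[OF r(1) s(1) um] submod_smult[OF N s(1)] r(2) by (simp add: colon_def)
      ultimately show ?thesis using cong_mod_mem[OF N] by blast
    qed
    \<comment> \<open>Adding \<open>u\<close> both to \<open>A\<close> and to \<open>L\<close> stays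
      inside \<open>F\<close>, so the maximality of \<open>L\<close> forces \<open>u\<close> into
      \<open>L\<close>.\<close>
    then have "add_gen L u \<in> F"
      unfolding F_def using add_gen_submod[OF A(1) um] add_gen_superset[OF A(1) um] A(2,3,4) u
      by (auto intro!: exI[of _ "insert u A"])
    then show ?thesis using L(2) add_gen_superset[OF A(1) um] add_gen_self[OF A(1) um] by blast
  qed
  have "P \<in> colon N ` A" if P: "P \<in> max_colons N" for P
  proof (rule ccontr)
    assume no: "P \<notin> colon N ` A"
    obtain u where u: "u \<in> U" "P = colon N u" using P by (auto simp: max_colons_def U_def)
    have "\<not> Q \<subseteq> P" if Q: "Q \<in> colon N ` A" for Q
    proof
      assume "Q \<subseteq> P"
      obtain v where v: "v \<in> A" "Q = colon N v" using Q by blast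
      then have "Q \<in> max_colons N" using A(4) by (auto simp: U_def)
      moreover have "P \<in> colon N ` (carrier M - N)" using P by (simp add: max_colons_def)
      ultimately have "P = Q" using \<open>Q \<subseteq> P\<close> unfolding max_colons_def by blast
      then show False using no v by blast
    qed
    moreover have "ideal Q R" if "Q \<in> colon N ` A" for Q
      using that A(4) colon_ideal[OF N] by (auto simp: U_def)
    moreover have "\<not> carrier R \<subseteq> P" using u by (auto simp: U_def colon_def)
    ultimately obtain r where r: "r \<in> carrier R" "\<forall>Q\<in>colon N ` A. r \<in> Q" "r \<notin> P"
      using prime_contains_Inter[of "colon N ` A" P "carrier R"] A(3)
        max_colons_prime[OF N P] R.oneideal by blast
    then have "r \<odot>\<^bsub>M\<^esub> u \<in> N" using A(5) U_L[OF u(1)] by blast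
    then show False using r u by (simp add: colon_def)
  qed
  then have "max_colons N \<subseteq> colon N ` A" by blast
  then show ?thesis using A(3) by (meson finite_imageI finite_subset)
qed

text \<open>Every zero divisor on \<open>M/N\<close> lies in a member of
  \<open>max_colons N\<close>, and such a member contains \<open>insert x J\<close> only if
  \<open>kills (insert x J) N\<close>. Prime avoidance is applied to the finite union over all
  \<open>N\<close>, which yields a single element for all quotients at once.\<close>

lemma exists_nzd_in_coset:
  assumes "finite \<N>" "\<And>N. N \<in> \<N> \<Longrightarrow> submod N" "ideal J R" "x \<in> carrier R"
    and "\<And>N. N \<in> \<N> \<Longrightarrow> \<not> kills (insert x J) N"
  shows "\<exists>j\<in>J. \<forall>N\<in>\<N>. nzd N (x \<oplus> j)"
proof -
  have "\<exists>j\<in>J. \<forall>P\<in>(\<Union>N\<in>\<N>. max_colons N). x \<oplus> j \<notin> P"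
  proof (rule coset_prime_avoidance[OF _ _ assms(3,4)])
    show "\<not> insert x J \<subseteq> P" if P: "P \<in> (\<Union>N\<in>\<N>. max_colons N)" for P
    proof
      assume a: "insert x J \<subseteq> P"
      from P obtain N where N: "N \<in> \<N>" "P \<in> max_colons N" by blast
      from N(2) obtain u where u: "u \<in> carrier M - N" "P = colon N u" by (auto simp: max_colons_def)
      have "kills (insert x J) N"
        unfolding kills_def by (rule bexI[OF _ u(1)]) (use a u(2) in \<open>auto simp: colon_def\<close>)
      then show False using assms(5)[OF N(1)] by blast
    qed
    show "finite (\<Union>N\<in>\<N>. max_colons N)"
      by (rule finite_UN_I[OF assms(1) finite_max_colons[OF assms(2)]])
    show "primeideal P R" if P: "P \<in> (\<Union>N\<in>\<N>. max_colons N)" for P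
      using P by (rule UN_E) (rule max_colons_prime[OF assms(2)])
  qed
  then obtain j where j: "j \<in> J" "\<And>N P. N \<in> \<N> \<Longrightarrow> P \<in> max_colons N \<Longrightarrow> x \<oplus> j \<notin> P" by blast
  have jc: "x \<oplus> j \<in> carrier R" using ideal.Icarr[OF assms(3) j(1)] assms(4) by simp
  have "nzd N (x \<oplus> j)" if N: "N \<in> \<N>" for N
    unfolding nzd_def
  proof (intro ballI impI, rule ccontr)
    fix u assume "u \<in> carrier M" "(x \<oplus> j) \<odot>\<^bsub>M\<^esub> u \<in> N" "u \<notin> N"
    then show False
      using max_colons_above[OF assms(2)[OF N], of u] j(2)[OF N] jc by (auto simp: colon_def)
  qed
  then show ?thesis by (intro bexI[OF _ j(1)] ballI)
qed

text \<open>The coset of zero. Several submodules at once are what the proof of Rees' theorem asks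
  for: one \<open>z\<close> must serve all initial segments of two sequences.\<close>

lemma exists_nzd_in_ideal:
  assumes "finite \<N>" "\<And>N. N \<in> \<N> \<Longrightarrow> submod N" "ideal J R" "\<And>N. N \<in> \<N> \<Longrightarrow> \<not> kills J N"
  shows "\<exists>z\<in>J. \<forall>N\<in>\<N>. nzd N z"
proof -
  have J: "insert \<zero> J = J" using ideal_zero[OF assms(3)] by blast
  have nk: "\<not> kills (insert \<zero> J) N" if "N \<in> \<N>" for N
    unfolding J by (rule assms(4)[OF that])
  obtain j where j: "j \<in> J" "\<forall>N\<in>\<N>. nzd N (\<zero> \<oplus> j)"
    by (rule bexE[OF exists_nzd_in_coset[OF assms(1) assms(2) assms(3) R.zero_closed nk]])
  have "\<zero> \<oplus> j = j" by (rule R.l_zero[OF ideal.Icarr[OF assms(3) j(1)]])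
  then have "\<forall>N\<in>\<N>. nzd N j" using j(2) by (simp only:)
  then show ?thesis using j(1) by (rule bexI)
qed

lemma nzd_not_kills: "nzd N r \<Longrightarrow> r \<in> J \<Longrightarrow> \<not> kills J N"
  unfolding nzd_def kills_def by blast

section \<open>Regular sequences and the theorem of Rees\<close>

lemma nzd_cong:
  assumes "submod N" "nzd N r" "r \<in> carrier R" "x \<in> carrier M" "y \<in> carrier M"
    and "cong_mod N (r \<odot>\<^bsub>M\<^esub> x) (r \<odot>\<^bsub>M\<^esub> y)"
  shows "cong_mod N x y"
proof -
  have "r \<odot>\<^bsub>M\<^esub> (x \<ominus>\<^bsub>M\<^esub> y) = r \<odot>\<^bsub>M\<^esub> x \<ominus>\<^bsub>M\<^esub> r \<odot>\<^bsub>M\<^esub> y"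
    using assms(3,4,5) by (simp add: a_minus_def smult_r_distr smult_r_minus)
  then have "r \<odot>\<^bsub>M\<^esub> (x \<ominus>\<^bsub>M\<^esub> y) \<in> N" using assms(6) by (simp add: cong_mod_def)
  moreover have "x \<ominus>\<^bsub>M\<^esub> y \<in> carrier M" using assms(4,5) by simp
  ultimately have "x \<ominus>\<^bsub>M\<^esub> y \<in> N" using assms(2) by (simp add: nzd_def)
  then show ?thesis using assms(4,5) by (simp add: cong_mod_def)
qed

lemma add_multE:
  assumes "x \<in> add_mult N a"
  obtains v where "v \<in> carrier M" "cong_mod N x (a \<odot>\<^bsub>M\<^esub> v)"
  using assms unfolding add_mult_def by blast

lemma add_multI: "v \<in> carrier M \<Longrightarrow> cong_mod N x (a \<odot>\<^bsub>M\<^esub> v) \<Longrightarrow> x \<in> add_mult N a"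
  unfolding add_mult_def by blast

text \<open>From \<open>a u = z v\<close> modulo \<open>N\<close> one gets \<open>v = a w\<close>,
  as \<open>z\<close> is regular modulo \<open>N + aM\<close>; cancelling \<open>a\<close> leaves
  \<open>u = z w\<close>. This is the half of swapping two regular elements that holds in any ring;
  the other half is \<open>nzd_swap\<close>.\<close>

lemma nzd_exchange:
  assumes N: "submod N" and a: "a \<in> carrier R" and z: "z \<in> carrier R"
    and nzd: "nzd N a" "nzd (add_mult N a) z"
  shows "nzd (add_mult N z) a"
  unfolding nzd_def
proof (intro ballI impI)
  fix u assume u: "u \<in> carrier M" "a \<odot>\<^bsub>M\<^esub> u \<in> add_mult N z"
  obtain v where v: "v \<in> carrier M" "cong_mod N (a \<odot>\<^bsub>M\<^esub> u) (z \<odot>\<^bsub>M\<^esub> v)"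
    using u(2) by (rule add_multE)
  have "z \<odot>\<^bsub>M\<^esub> v \<in> add_mult N a" by (rule add_multI[OF u(1) cong_mod_sym[OF N v(2)]])
  then have "v \<in> add_mult N a" using nzd(2) v(1) by (simp add: nzd_def)
  then obtain w where w: "w \<in> carrier M" "cong_mod N v (a \<odot>\<^bsub>M\<^esub> w)" by (rule add_multE)
  have "cong_mod N (z \<odot>\<^bsub>M\<^esub> v) (a \<odot>\<^bsub>M\<^esub> (z \<odot>\<^bsub>M\<^esub> w))"
    using cong_mod_smult[OF N w(2) z] smult_commute[OF z a w(1)] by simp
  then have "cong_mod N (a \<odot>\<^bsub>M\<^esub> u) (a \<odot>\<^bsub>M\<^esub> (z \<odot>\<^bsub>M\<^esub> w))" by (rule cong_mod_trans[OF N v(2)])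
  then have "cong_mod N u (z \<odot>\<^bsub>M\<^esub> w)"
    by (rule nzd_cong[OF N nzd(1) a u(1) smult_closed[OF z w(1)]])
  then show "u \<in> add_mult N z" by (rule add_multI[OF w(1)])
qed

lemma add_mult_commute:
  assumes N: "submod N" and a: "a \<in> carrier R" and b: "b \<in> carrier R"
  shows "add_mult (add_mult N a) b = add_mult (add_mult N b) a"
proof -
  have "add_mult (add_mult N a) b \<subseteq> add_mult (add_mult N b) a"
    if ab: "a \<in> carrier R" "b \<in> carrier R" for a b
  proof -
    note Na = add_mult_submod[OF N ab(1)] and Nb = add_mult_submod[OF N ab(2)]
    note Nba = add_mult_submod[OF Nb ab(1)]
    note sub = add_mult_superset[OF Nb ab(1)]
    have "add_mult N a \<subseteq> add_mult (add_mult N b) a"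
      using add_mult_least[OF N Nba subset_trans[OF add_mult_superset[OF N ab(2)] sub]]
        add_mult_mult[OF Nb ab(1)] .
    then show ?thesis
      using add_mult_least[OF Na Nba] add_mult_mult[OF N ab(2)] sub by blast
  qed
  then show ?thesis using a b by blast
qed

text \<open>\<open>ext N xs\<close> is \<open>N + (xs)M\<close>, and \<open>reg N xs\<close> says that \<open>xs\<close> is a weakly regular sequence on \<open>M/N\<close>.\<close>

primrec ext :: "'c set \<Rightarrow> 'a list \<Rightarrow> 'c set"
  where
    "ext N [] = N"
  | "ext N (x # xs) = ext (add_mult N x) xs"

primrec reg :: "'c set \<Rightarrow> 'a list \<Rightarrow> bool"
  where
    "reg N [] = True"
  | "reg N (x # xs) = (nzd N x \<and> reg (add_mult N x) xs)"

text \<open>One submodule for each initial segment, the empty and the full one included. An element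
  that is regular modulo all of them can be moved in front of \<open>xs\<close>.\<close>

primrec exts :: "'c set \<Rightarrow> 'a list \<Rightarrow> 'c set set"
  where
    "exts N [] = {N}"
  | "exts N (x # xs) = insert N (exts (add_mult N x) xs)"

lemma ext_append [simp]: "ext N (xs @ ys) = ext (ext N xs) ys"
  by (induction xs arbitrary: N) simp_all

lemma reg_append [simp]: "reg N (xs @ ys) \<longleftrightarrow> reg N xs \<and> reg (ext N xs) ys"
  by (induction xs arbitrary: N) simp_all

lemma ext_submod: "submod N \<Longrightarrow> set xs \<subseteq> carrier R \<Longrightarrow> submod (ext N xs)"
  by (induction xs arbitrary: N) (simp_all add: add_mult_submod)

lemma ext_superset: "submod N \<Longrightarrow> set xs \<subseteq> carrier R \<Longrightarrow> N \<subseteq> ext N xs"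
proof (induction xs arbitrary: N)
  case (Cons x xs)
  then have "x \<in> carrier R" "set xs \<subseteq> carrier R" by simp_all
  then show ?case
    using subset_trans[OF add_mult_superset Cons.IH[OF add_mult_submod]] Cons.prems(1) by simp
qed simp

lemma ext_mult:
  "submod N \<Longrightarrow> set xs \<subseteq> carrier R \<Longrightarrow> x \<in> set xs \<Longrightarrow> v \<in> carrier M \<Longrightarrow> x \<odot>\<^bsub>M\<^esub> v \<in> ext N xs"
proof (induction xs arbitrary: N)
  case (Cons y xs)
  have y: "y \<in> carrier R" "set xs \<subseteq> carrier R" using Cons.prems by simp_all
  note Ny = add_mult_submod[OF Cons.prems(1) y(1)]
  show ?case
  proof (cases "x = y")
    case True
    then show ?thesis
      using add_mult_mult[OF Cons.prems(1) y(1) Cons.prems(4)] ext_superset[OF Ny y(2)] by auto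
  next
    case False
    then show ?thesis using Cons.IH[OF Ny y(2)] Cons.prems by simp
  qed
qed simp

lemma ext_least:
  "submod N \<Longrightarrow> set xs \<subseteq> carrier R \<Longrightarrow> submod L \<Longrightarrow> N \<subseteq> L \<Longrightarrow>
    (\<And>x v. x \<in> set xs \<Longrightarrow> v \<in> carrier M \<Longrightarrow> x \<odot>\<^bsub>M\<^esub> v \<in> L) \<Longrightarrow> ext N xs \<subseteq> L"
proof (induction xs arbitrary: N)
  case (Cons y xs)
  have y: "y \<in> carrier R" "set xs \<subseteq> carrier R" using Cons.prems by simp_all
  have "add_mult N y \<subseteq> L" using add_mult_least[OF Cons.prems(1,3,4)] Cons.prems(5) by simp
  then show ?case
    using Cons.IH[OF add_mult_submod[OF Cons.prems(1) y(1)] y(2) Cons.prems(3)] Cons.prems(5) by simp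
qed simp

lemma ext_commute:
  assumes "submod N" "a \<in> carrier R" "set xs \<subseteq> carrier R"
  shows "ext (add_mult N a) xs = add_mult (ext N xs) a"
  using assms(1,3)
proof (induction xs arbitrary: N)
  case (Cons x xs)
  then show ?case
    using add_mult_commute[OF Cons.prems(1) assms(2), of x] Cons.IH[OF add_mult_submod] by simp
qed simp

lemma exts_submod: "submod N \<Longrightarrow> set xs \<subseteq> carrier R \<Longrightarrow> L \<in> exts N xs \<Longrightarrow> submod L"
proof (induction xs arbitrary: N)
  case (Cons x xs)
  then show ?case using Cons.IH[OF add_mult_submod[OF Cons.prems(1), of x]] by auto
qed simp

lemma finite_exts: "finite (exts N xs)"
  by (induction xs arbitrary: N) simp_all

lemma ext_in_exts: "ext N xs \<in> exts N xs"
  by (induction xs arbitrary: N) simp_all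

text \<open>At each stage the next entry of the sequence is a nonzerodivisor in \<open>J\<close>.
  The additional entry \<open>x\<close> serves the last stage, \<open>ext N xs\<close>.\<close>

lemma exts_not_kills:
  "reg N (xs @ [x]) \<Longrightarrow> set (xs @ [x]) \<subseteq> J \<Longrightarrow> L \<in> exts N xs \<Longrightarrow> \<not> kills J L"
proof (induction xs arbitrary: N)
  case Nil
  then show ?case using nzd_not_kills[of N x J] by simp
next
  case (Cons y xs)
  then show ?case using nzd_not_kills[of N y J] by auto
qed

text \<open>Starting behind \<open>xs\<close>, the element \<open>z\<close> passes one entry at a
  time by \<open>nzd_exchange\<close>.\<close>

lemma reg_exchange:
  assumes "submod N" "set xs \<subseteq> carrier R" "z \<in> carrier R" "reg N xs" "\<forall>L\<in>exts N xs. nzd L z"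
  shows "reg (add_mult N z) xs"
  using assms(1,2,4,5)
proof (induction xs arbitrary: N)
  case (Cons x xs)
  have x: "x \<in> carrier R" "set xs \<subseteq> carrier R" using Cons.prems by simp_all
  have L: "nzd L z" if "L \<in> exts (add_mult N x) xs" for L using Cons.prems(4) that by simp
  have "add_mult N x \<in> exts (add_mult N x) xs" by (cases xs) simp_all
  then have "nzd (add_mult N z) x"
    using nzd_exchange[OF Cons.prems(1) x(1) assms(3)] Cons.prems(3) L by simp
  moreover have "reg (add_mult (add_mult N x) z) xs"
    using Cons.IH[OF add_mult_submod[OF Cons.prems(1) x(1)] x(2)] Cons.prems(3) L by simp
  ultimately show ?case using add_mult_commute[OF Cons.prems(1) x(1) assms(3)] by simp
qed simp

text \<open>Conceptually both sides express that Ext^1(R/J, M/N) is nonzero, which mentions neither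
  \<open>x\<close> nor \<open>y\<close>. Concretely, a class \<open>u\<close> killed by
  \<open>J\<close> modulo \<open>N + xM\<close> satisfies \<open>y u = x v\<close> modulo
  \<open>N\<close>, and \<open>v\<close> is the required class modulo \<open>N + yM\<close>.\<close>

lemma kills_add_mult_swap:
  assumes N: "submod N" and J: "J \<subseteq> carrier R" "x \<in> J" "y \<in> J" and nzd: "nzd N x" "nzd N y"
    and k: "kills J (add_mult N x)"
  shows "kills J (add_mult N y)"
proof -
  have x: "x \<in> carrier R" and y: "y \<in> carrier R" using J by auto
  obtain u where u: "u \<in> carrier M" "u \<notin> add_mult N x" "\<And>r. r \<in> J \<Longrightarrow> r \<odot>\<^bsub>M\<^esub> u \<in> add_mult N x"
    using k unfolding kills_def by blast
  obtain v where v: "v \<in> carrier M" "cong_mod N (y \<odot>\<^bsub>M\<^esub> u) (x \<odot>\<^bsub>M\<^esub> v)"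
    using u(3)[OF J(3)] by (rule add_multE)
  have "v \<notin> add_mult N y"
  proof
    assume "v \<in> add_mult N y"
    then obtain w where w: "w \<in> carrier M" "cong_mod N v (y \<odot>\<^bsub>M\<^esub> w)" by (rule add_multE)
    have "cong_mod N (x \<odot>\<^bsub>M\<^esub> v) (y \<odot>\<^bsub>M\<^esub> (x \<odot>\<^bsub>M\<^esub> w))"
      using cong_mod_smult[OF N w(2) x] smult_commute[OF x y w(1)] by simp
    then have "cong_mod N (y \<odot>\<^bsub>M\<^esub> u) (y \<odot>\<^bsub>M\<^esub> (x \<odot>\<^bsub>M\<^esub> w))" by (rule cong_mod_trans[OF N v(2)])
    then have "cong_mod N u (x \<odot>\<^bsub>M\<^esub> w)"
      by (rule nzd_cong[OF N nzd(2) y u(1) smult_closed[OF x w(1)]])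
    then have "u \<in> add_mult N x" by (rule add_multI[OF w(1)])
    then show False using u(2) by simp
  qed
  moreover have "r \<odot>\<^bsub>M\<^esub> v \<in> add_mult N y" if r: "r \<in> J" for r
  proof -
    have rc: "r \<in> carrier R" using r J(1) by blast
    obtain w where w: "w \<in> carrier M" "cong_mod N (r \<odot>\<^bsub>M\<^esub> u) (x \<odot>\<^bsub>M\<^esub> w)"
      using u(3)[OF r] by (rule add_multE)
    have 1: "cong_mod N (r \<odot>\<^bsub>M\<^esub> (y \<odot>\<^bsub>M\<^esub> u)) (x \<odot>\<^bsub>M\<^esub> (y \<odot>\<^bsub>M\<^esub> w))"
      using cong_mod_smult[OF N w(2) y] smult_commute[OF y rc u(1)] smult_commute[OF y x w(1)] by simp
    have "cong_mod N (r \<odot>\<^bsub>M\<^esub> (y \<odot>\<^bsub>M\<^esub> u)) (x \<odot>\<^bsub>M\<^esub> (r \<odot>\<^bsub>M\<^esub> v))"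
      using cong_mod_smult[OF N v(2) rc] smult_commute[OF rc x v(1)] by simp
    \<comment> \<open>Two expressions for \<open>r y u\<close> give \<open>x (r v) = x (y w)\<close>
      modulo \<open>N\<close>, and \<open>x\<close> can be cancelled.\<close>
    from cong_mod_trans[OF N cong_mod_sym[OF N this] 1]
    have "cong_mod N (r \<odot>\<^bsub>M\<^esub> v) (y \<odot>\<^bsub>M\<^esub> w)"
      by (rule nzd_cong[OF N nzd(1) x smult_closed[OF rc v(1)] smult_closed[OF y w(1)]])
    then show ?thesis by (rule add_multI[OF w(1)])
  qed
  ultimately show ?thesis using v(1) unfolding kills_def by blast
qed

text \<open>Rees' theorem, by exchanging the last elements of both sequences for a common element \<open>z\<close> that
  is a nonzerodivisor modulo all shorter initial segments, so that \<open>z\<close> may be moved to the front.\<close>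

lemma kills_ext_transfer:
  assumes "submod N" "ideal J R" "set xs \<subseteq> J" "set ys \<subseteq> J" "reg N xs" "reg N ys"
    and "length xs = length ys" "kills J (ext N xs)"
  shows "kills J (ext N ys)"
  using assms(1,3-)
proof (induction "length xs" arbitrary: N xs ys)
  case 0
  then show ?case by simp
next
  case (Suc n)
  have J: "J \<subseteq> carrier R" using ideal.Icarr[OF assms(2)] by blast
  obtain xs' x where xs: "xs = xs' @ [x]" using Suc.hyps(2) by (metis length_0_conv nat.distinct(1) rev_exhaust)
  obtain ys' y where ys: "ys = ys' @ [y]"
    using Suc.hyps(2) Suc.prems(6) by (metis length_0_conv nat.distinct(1) rev_exhaust)
  have len: "n = length xs'" "length xs' = length ys'" using Suc.hyps(2) Suc.prems(6) xs ys by simp_all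
  have in_J: "set xs' \<subseteq> J" "x \<in> J" "set ys' \<subseteq> J" "y \<in> J" using Suc.prems(2,3) xs ys by simp_all
  then have in_R: "set xs' \<subseteq> carrier R" "set ys' \<subseteq> carrier R" using J by auto
  have r: "reg N xs'" "nzd (ext N xs') x" "reg N ys'" "nzd (ext N ys') y"
    using Suc.prems(4,5) xs ys by simp_all
  note N = Suc.prems(1)
  let ?E = "exts N xs' \<union> exts N ys'"
  have fin: "finite ?E" by (simp add: finite_exts)
  have sub: "submod L" if "L \<in> ?E" for L using that exts_submod[OF N] in_R by blast
  have nk: "\<not> kills J L" if "L \<in> ?E" for L
    using that exts_not_kills Suc.prems(2-5) xs ys by blast
  obtain z where z: "z \<in> J" "\<forall>L\<in>?E. nzd L z"
    by (rule bexE[OF exists_nzd_in_ideal[OF fin sub assms(2) nk]])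
  have zc: "z \<in> carrier R" using z(1) J by blast
  have nz: "nzd (ext N xs') z" "nzd (ext N ys') z" using z(2) ext_in_exts by blast+
  have "kills J (add_mult (ext N xs') z)"
    using kills_add_mult_swap[OF ext_submod[OF N in_R(1)] J in_J(2) z(1) r(2) nz(1)] Suc.prems(7) xs by simp
  then have k: "kills J (ext (add_mult N z) xs')" using ext_commute[OF N zc in_R(1)] by simp
  have "kills J (ext (add_mult N z) ys')"
  proof (rule Suc.hyps(1)[OF len(1) add_mult_submod[OF N zc] in_J(1,3) _ _ len(2) k])
    show "reg (add_mult N z) xs'" by (rule reg_exchange[OF N in_R(1) zc r(1)]) (use z(2) in blast)
    show "reg (add_mult N z) ys'" by (rule reg_exchange[OF N in_R(2) zc r(3)]) (use z(2) in blast)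
  qed
  then have "kills J (add_mult (ext N ys') z)" using ext_commute[OF N zc in_R(2)] by simp
  then have "kills J (add_mult (ext N ys') y)"
    by (rule kills_add_mult_swap[OF ext_submod[OF N in_R(2)] J z(1) in_J(4) nz(2) r(4)])
  then show ?case using ys by simp
qed

text \<open>If \<open>ys\<close> had no continuation in \<open>J\<close>, then \<open>J\<close>, and
  by \<open>k\<close> also \<open>I\<close>, would kill a class modulo \<open>ext N ys\<close>.
  Rees' theorem moves this to the initial segment of \<open>zs\<close> of the same length, where the
  next entry of \<open>zs\<close> forbids it. Hypothesis \<open>k\<close> is the interface: it holds
  for \<open>J = I\<close>, for ideals of equal radical modulo the annihilator, and for ideals that
  differ by an element mapping \<open>M\<close> into \<open>N\<close>.\<close>

lemma reg_extend:
  assumes N: "submod N" and I: "ideal I R" and J: "ideal J R" "J \<subseteq> I"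
    and zs: "set zs \<subseteq> I" "reg N zs"
    and k: "\<And>L. submod L \<Longrightarrow> N \<subseteq> L \<Longrightarrow> kills J L \<Longrightarrow> kills I L"
    and ys: "set ys \<subseteq> J" "reg N ys" "length ys \<le> length zs"
  shows "\<exists>ys'. set ys' \<subseteq> J \<and> reg (ext N ys) ys' \<and> length ys + length ys' = length zs"
  using ys
proof (induction "length zs - length ys" arbitrary: ys)
  case 0
  then show ?case by (intro exI[of _ "[]"]) simp
next
  case (Suc n)
  have JR: "J \<subseteq> carrier R" using ideal.Icarr[OF J(1)] by blast
  have ysR: "set ys \<subseteq> carrier R" using Suc.prems(1) JR by blast
  let ?ps = "take (length ys) zs" and ?z = "zs ! length ys"
  have lt: "length ys < length zs" using Suc.hyps(2) by simp
  have "zs = ?ps @ ?z # drop (Suc (length ys)) zs" using id_take_nth_drop[OF lt] .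
  then have "reg N (?ps @ ?z # drop (Suc (length ys)) zs)" using zs(2) by simp
  then have ps: "reg N ?ps" "nzd (ext N ?ps) ?z" by simp_all
  have zI: "?z \<in> I" "set ?ps \<subseteq> I" using zs(1) lt nth_mem[OF lt] set_take_subset[of "length ys" zs] by auto
  have "\<not> kills J (ext N ys)"
  proof
    assume "kills J (ext N ys)"
    then have "kills I (ext N ys)" by (rule k[OF ext_submod[OF N ysR] ext_superset[OF N ysR]])
    then have "kills I (ext N ?ps)"
      using kills_ext_transfer[OF N I _ zI(2) Suc.prems(2) ps(1)] Suc.prems(1) J(2) lt by auto
    then show False using nzd_not_kills[OF ps(2) zI(1)] by simp
  qed
  then obtain y where y: "y \<in> J" "nzd (ext N ys) y"
    using exists_nzd_in_ideal[of "{ext N ys}" J] J(1) ext_submod[OF N ysR] by auto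
  have "\<exists>ys'. set ys' \<subseteq> J \<and> reg (ext N (ys @ [y])) ys' \<and> length (ys @ [y]) + length ys' = length zs"
    by (rule Suc.hyps(1)) (use Suc.hyps(2) Suc.prems y lt in simp_all)
  then obtain ys' where ys': "set ys' \<subseteq> J" "reg (add_mult (ext N ys) y) ys'"
    "Suc (length ys + length ys') = length zs" by auto
  then show ?case using y by (intro exI[of _ "y # ys'"]) simp
qed

section \<open>Regular sequences among the generators of an ideal\<close>

lemma kills_mono: "submod L \<Longrightarrow> (\<And>u. u \<in> carrier M \<Longrightarrow> A \<subseteq> colon L u \<Longrightarrow> B \<subseteq> colon L u) \<Longrightarrow>
    A \<subseteq> carrier R \<Longrightarrow> kills A L \<Longrightarrow> kills B L"
  unfolding kills_def colon_def by blast

text \<open>Coset avoidance makes \<open>y = x + j\<close> regular on \<open>M/N\<close>, and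
  \<open>y\<close> continues to a sequence as long as \<open>zs\<close> in the full ideal. On
  \<open>M/(N + yM)\<close> the element \<open>x\<close> acts as \<open>-j\<close>, so there the
  full ideal and \<open>Idl (set xs)\<close> kill the same classes, and the continuation can be
  replaced by one inside the smaller ideal.\<close>

lemma reg_first_generator:
  assumes N: "submod N" and xs: "set (x # xs) \<subseteq> carrier R"
    and zs: "set zs \<subseteq> Idl (set (x # xs))" "reg N zs" "length zs = Suc (length xs)"
  shows "\<exists>j\<in>Idl (set xs). nzd N (x \<oplus> j) \<and>
    (\<exists>ws. set ws \<subseteq> Idl (set xs) \<and> reg (add_mult N (x \<oplus> j)) ws \<and> length ws = length xs)"
proof -
  define J where "J = Idl (set (x # xs))"
  define J' where "J' = Idl (set xs)"
  have c: "x \<in> carrier R" "set xs \<subseteq> carrier R" "insert x (set xs) \<subseteq> carrier R" using xs by simp_all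
  have J_eq: "J = Idl (insert x (set xs))" by (simp add: J_def)
  note J = Idl_insert_subset[OF J_eq c(3)]
  have J': "ideal J' R" "set xs \<subseteq> J'"
    unfolding J'_def using R.genideal_ideal[OF c(2)] R.genideal_self[OF c(2)] by blast+
  have sub: "J' \<subseteq> J" using J(3) by (simp add: J'_def)
  have J'R: "J' \<subseteq> carrier R" using ideal.Icarr[OF J'(1)] by blast
  obtain z zs' where z: "zs = z # zs'" using zs(3) by (cases zs) simp_all
  have "\<not> kills J N" by (rule nzd_not_kills[of N z]) (use zs(1,2) z in \<open>simp_all add: J_def\<close>)
  moreover have "kills (insert x J') N \<Longrightarrow> kills J N"
  proof (rule kills_mono[OF N])
    show "J \<subseteq> colon N u" if "u \<in> carrier M" "insert x J' \<subseteq> colon N u" for u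
      using J(4)[OF colon_ideal[OF N that(1)]] that(2) J'(2) by blast
  qed (use J'R c(1) in blast)+
  ultimately have nk: "\<not> kills (insert x J') L" if "L \<in> {N}" for L using that by auto
  have "\<exists>j\<in>J'. \<forall>L\<in>{N}. nzd L (x \<oplus> j)"
    by (rule exists_nzd_in_coset[OF _ _ J'(1) c(1) nk]) (use N in auto)
  then obtain j where j: "j \<in> J'" "nzd N (x \<oplus> j)" by blast
  have jc: "j \<in> carrier R" using j(1) J'R by blast
  define y where "y = x \<oplus> j"
  have y: "y \<in> J" "y \<in> carrier R" "nzd N y"
    using ideal_add[OF J(1,2)] j sub c(1) jc by (auto simp: y_def)
  note Ny = add_mult_submod[OF N y(2)]
  \<comment> \<open>Both ideals of \<open>reg_extend\<close> are \<open>J\<close>, so its hypothesis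
    on \<open>kills\<close> is trivial.\<close>
  have "\<exists>ys'. set ys' \<subseteq> J \<and> reg (ext N [y]) ys' \<and> length [y] + length ys' = length zs"
    by (rule reg_extend[OF N J(1) J(1) order_refl _ zs(2)]) (use zs y in \<open>simp_all add: J_def\<close>)
  then obtain ys' where ys': "set ys' \<subseteq> J" "reg (add_mult N y) ys'" "length ys' = length xs"
    using zs(3) by auto
  have "\<exists>ws. set ws \<subseteq> J' \<and> reg (ext (add_mult N y) []) ws \<and> length ([]::'a list) + length ws = length ys'"
  proof (rule reg_extend[OF Ny J(1) J'(1) sub ys'(1,2)])
    fix L assume L: "submod L" "add_mult N y \<subseteq> L" "kills J' L"
    show "kills J L"
    proof (rule kills_mono[OF L(1) _ J'R L(3)])
      fix u assume u: "u \<in> carrier M" "J' \<subseteq> colon L u"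
      \<comment> \<open>\<open>y\<close> maps \<open>M\<close> into \<open>L\<close> and so belongs
        to every colon ideal of \<open>L\<close>; a colon ideal containing \<open>j\<close> then
        contains \<open>x\<close> as well.\<close>
      have "y \<in> colon L u" using add_mult_mult[OF N y(2) u(1)] L(2) y(2) by (auto simp: colon_def)
      moreover have "y = j \<oplus> x" using c(1) jc by (simp add: y_def R.a_comm)
      ultimately have "x \<in> colon L u"
        using ideal_add_cancel[OF colon_ideal[OF L(1) u(1)], of j x] j(1) u(2) c(1) by auto
      then show "J \<subseteq> colon L u" using J(4)[OF colon_ideal[OF L(1) u(1)]] u(2) J'(2) by blast
    qed
  qed simp_all
  then show ?thesis using j ys'(3) unfolding y_def J'_def by auto
qed

text \<open>Each generator \<open>x\<close> is changed only by an element \<open>j\<close> of the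
  ideal of the later ones, so the generated ideal survives. The sequence \<open>zs\<close> merely
  witnesses that its grade is large enough.\<close>

lemma reg_generators:
  assumes "submod N" "set xs \<subseteq> carrier R"
    and "set zs \<subseteq> Idl (set xs)" "reg N zs" "length zs = length xs"
  shows "\<exists>ys. set ys \<subseteq> carrier R \<and> reg N ys \<and> length ys = length xs \<and> Idl (set ys) = Idl (set xs)"
  using assms
proof (induction xs arbitrary: N zs)
  case Nil
  then show ?case by (intro exI[of _ "[]"]) simp
next
  case (Cons x xs)
  have c: "x \<in> carrier R" "set xs \<subseteq> carrier R" "insert x (set xs) \<subseteq> carrier R" using Cons.prems(2) by simp_all
  obtain j ws where j: "j \<in> Idl (set xs)" "nzd N (x \<oplus> j)" "set ws \<subseteq> Idl (set xs)"
    "reg (add_mult N (x \<oplus> j)) ws" "length ws = length xs"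
    using reg_first_generator[OF Cons.prems(1-4)] Cons.prems(5) by auto
  have jc: "j \<in> carrier R" using ideal.Icarr[OF R.genideal_ideal[OF c(2)] j(1)] .
  then have yc: "x \<oplus> j \<in> carrier R" using c(1) by simp
  obtain ys where ys: "set ys \<subseteq> carrier R" "reg (add_mult N (x \<oplus> j)) ys" "length ys = length xs"
    "Idl (set ys) = Idl (set xs)"
    using Cons.IH[OF add_mult_submod[OF Cons.prems(1) yc] c(2) j(3,4,5)] by blast
  have c': "insert (x \<oplus> j) (set ys) \<subseteq> carrier R" using yc ys(1) by simp
  note X = Idl_insert_subset[OF refl c(3)]
  note Y = Idl_insert_subset[OF refl c']
  have self: "set xs \<subseteq> Idl (set xs)" "set ys \<subseteq> Idl (set ys)"
    using R.genideal_self[OF c(2)] R.genideal_self[OF ys(1)] .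
  have "j \<in> Idl (insert (x \<oplus> j) (set ys))" using Y(3) ys(4) j(1) by blast
  moreover have "j \<oplus> x \<in> Idl (insert (x \<oplus> j) (set ys))" using Y(2) R.a_comm[OF jc c(1)] by simp
  ultimately have "x \<in> Idl (insert (x \<oplus> j) (set ys))"
    using ideal_add_cancel[OF Y(1) _ _ c(1)] by blast
  then have "Idl (insert x (set xs)) \<subseteq> Idl (insert (x \<oplus> j) (set ys))"
    using X(4)[OF Y(1)] Y(3) ys(4) self(1) by blast
  moreover have "x \<oplus> j \<in> Idl (insert x (set xs))" using ideal_add[OF X(1,2)] X(3) j(1) by blast
  then have "Idl (insert (x \<oplus> j) (set ys)) \<subseteq> Idl (insert x (set xs))"
    using Y(4)[OF X(1)] X(3) ys(4) self(2) by blast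
  ultimately show ?case using ys j(2) c' by (intro exI[of _ "(x \<oplus> j) # ys"]) auto
qed

section \<open>Regular sequences in the Jacobson radical\<close>

text \<open>The proof looks at the simple quotient of \<open>K\<close> by a maximal proper submodule above \<open>N\<close>.\<close>

lemma nakayama:
  assumes a: "a \<in> jacobson_radical R" and N: "submod N" and K: "submod K" "N \<subseteq> K"
    and sub: "\<And>u. u \<in> K \<Longrightarrow> \<exists>v\<in>K. cong_mod N u (a \<odot>\<^bsub>M\<^esub> v)"
  shows "K \<subseteq> N"
proof (rule ccontr)
  assume no: "\<not> K \<subseteq> N"
  have ac: "a \<in> carrier R" using a by (simp add: jacobson_radical_def)
  let ?F = "{L. submod L \<and> N \<subseteq> L \<and> L \<subset> K}"
  have "\<exists>L\<in>?F. \<forall>L'\<in>?F. L \<subseteq> L' \<longrightarrow> L' = L"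
  proof (rule maximal_submod_in_family)
    show "?F \<noteq> {}" using N K(2) no by blast
  qed simp
  then obtain L where L0: "L \<in> ?F" "\<forall>L'\<in>?F. L \<subseteq> L' \<longrightarrow> L' = L" by (rule bexE)
  then have L: "submod L" "N \<subseteq> L" "L \<subset> K" by simp_all
  obtain k where k: "k \<in> K" "k \<notin> L" using L(3) by blast
  have km: "k \<in> carrier M" using submod_mem[OF K(1) k(1)] .
  note G = add_gen_submod[OF L(1) km]
  have sup: "L \<subseteq> add_gen L k" "k \<in> add_gen L k"
    using add_gen_superset[OF L(1) km] add_gen_self[OF L(1) km] .
  have "add_gen L k \<subseteq> K"
  proof
    fix x assume "x \<in> add_gen L k"
    then obtain r where r: "r \<in> carrier R" "cong_mod L x (r \<odot>\<^bsub>M\<^esub> k)" unfolding add_gen_def by blast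
    have "cong_mod K x (r \<odot>\<^bsub>M\<^esub> k)" by (rule cong_mod_mono[OF _ r(2)]) (use L(3) in blast)
    then show "x \<in> K" using cong_mod_mem[OF K(1)] submod_smult[OF K(1) r(1) k(1)] by blast
  qed
  \<comment> \<open>\<open>K/L\<close> is simple, hence generated by the class of \<open>k\<close>;
    the \<open>v\<close> below is therefore a multiple of \<open>k\<close> modulo
    \<open>L\<close>.\<close>
  have "add_gen L k = K"
  proof (rule ccontr)
    assume "add_gen L k \<noteq> K"
    then have "add_gen L k \<in> ?F" using G \<open>add_gen L k \<subseteq> K\<close> sup(1) L(2) by blast
    then have "add_gen L k = L" using L0(2) sup(1) by blast
    then show False using sup(2) k(2) by simp
  qed
  obtain v where v: "v \<in> K" "cong_mod N k (a \<odot>\<^bsub>M\<^esub> v)" using sub[OF k(1)] by blast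
  then have "v \<in> add_gen L k" using \<open>add_gen L k = K\<close> by simp
  then obtain r where r: "r \<in> carrier R" "cong_mod L v (r \<odot>\<^bsub>M\<^esub> k)" unfolding add_gen_def by blast
  \<comment> \<open>So \<open>1 - a r\<close> kills \<open>k\<close> modulo \<open>L\<close>; being
    a unit, it forces \<open>k\<close> into \<open>L\<close>.\<close>
  have "cong_mod L k ((a \<otimes> r) \<odot>\<^bsub>M\<^esub> k)"
    using cong_mod_trans[OF L(1) cong_mod_mono[OF L(2) v(2)] cong_mod_smult[OF L(1) r(2) ac]]
      ac r(1) km by (simp add: smult_assoc1)
  then have "k \<ominus>\<^bsub>M\<^esub> (a \<otimes> r) \<odot>\<^bsub>M\<^esub> k \<in> L" by (simp add: cong_mod_def)
  moreover have "(\<one> \<ominus> a \<otimes> r) \<odot>\<^bsub>M\<^esub> k = k \<ominus>\<^bsub>M\<^esub> (a \<otimes> r) \<odot>\<^bsub>M\<^esub> k"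
    using ac r(1) km by (simp add: a_minus_def smult_l_distr smult_l_minus)
  ultimately have "\<one> \<ominus> a \<otimes> r \<in> colon L k" using ac r(1) by (simp add: colon_def)
  then have "\<one> \<in> colon L k" by (rule jacobson_one_minus[OF a r(1) colon_ideal[OF L(1) km]])
  then show False using k(2) km by (simp add: colon_def)
qed

text \<open>Let \<open>K/N\<close> be the annihilator of \<open>b\<close> in \<open>M/N\<close>. For
  \<open>u\<close> in \<open>K\<close> regularity of \<open>b\<close> modulo \<open>N + aM\<close>
  gives \<open>u = a v\<close> modulo \<open>N\<close>, and cancelling \<open>a\<close> from
  \<open>a b v\<close> puts \<open>v\<close> into \<open>K\<close>. Thus \<open>K = N + aK\<close>,
  and Nakayama's lemma applies.\<close>

lemma nzd_swap:
  assumes N: "submod N" and a: "a \<in> jacobson_radical R" and b: "b \<in> carrier R"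
    and nzd: "nzd N a" "nzd (add_mult N a) b"
  shows "nzd N b"
proof -
  have ac: "a \<in> carrier R" using a by (simp add: jacobson_radical_def)
  define K where "K = {u \<in> carrier M. b \<odot>\<^bsub>M\<^esub> u \<in> N}"
  have K: "submod K"
  proof (rule submoduleI)
    show "\<zero>\<^bsub>M\<^esub> \<in> K" using b submod_zero[OF N] by (simp add: K_def)
    show "\<ominus>\<^bsub>M\<^esub> x \<in> K" if "x \<in> K" for x
      using that b submod_uminus[OF N] by (simp add: K_def smult_r_minus)
    show "x \<oplus>\<^bsub>M\<^esub> y \<in> K" if "x \<in> K" "y \<in> K" for x y
      using that b submod_add[OF N] by (simp add: K_def smult_r_distr)
    show "r \<odot>\<^bsub>M\<^esub> x \<in> K" if "r \<in> carrier R" "x \<in> K" for r x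
      using that submod_smult[OF N that(1)] smult_commute[OF b that(1)] by (simp add: K_def)
  qed (simp add: K_def)
  have NK: "N \<subseteq> K" using submod_mem[OF N] submod_smult[OF N b] by (auto simp: K_def)
  have "K \<subseteq> N"
  proof (rule nakayama[OF a N K NK])
    fix u assume "u \<in> K"
    then have u: "u \<in> carrier M" "b \<odot>\<^bsub>M\<^esub> u \<in> N" by (simp_all add: K_def)
    have "b \<odot>\<^bsub>M\<^esub> u \<in> add_mult N a" using add_mult_superset[OF N ac] u(2) by blast
    then have "u \<in> add_mult N a" using nzd(2) u(1) by (simp add: nzd_def)
    then obtain v where v: "v \<in> carrier M" "cong_mod N u (a \<odot>\<^bsub>M\<^esub> v)" by (rule add_multE)
    have "b \<odot>\<^bsub>M\<^esub> (a \<odot>\<^bsub>M\<^esub> v) \<in> N" using cong_mod_mem[OF N cong_mod_smult[OF N v(2) b]] u(2) by blast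
    then have "a \<odot>\<^bsub>M\<^esub> (b \<odot>\<^bsub>M\<^esub> v) \<in> N" using smult_commute[OF b ac v(1)] by simp
    then have "b \<odot>\<^bsub>M\<^esub> v \<in> N" using nzd(1) smult_closed[OF b v(1)] unfolding nzd_def by blast
    then show "\<exists>v\<in>K. cong_mod N u (a \<odot>\<^bsub>M\<^esub> v)" using v by (auto simp: K_def)
  qed
  then show ?thesis unfolding nzd_def K_def by blast
qed

lemma reg_swap:
  assumes N: "submod N" and a: "a \<in> jacobson_radical R" and b: "b \<in> jacobson_radical R"
    and reg: "reg N (a # b # xs)"
  shows "reg N (b # a # xs)"
proof -
  have c: "a \<in> carrier R" "b \<in> carrier R" using a b by (simp_all add: jacobson_radical_def)
  show ?thesis
    using nzd_swap[OF N a c(2)] nzd_exchange[OF N c] add_mult_commute[OF N c] reg by simp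
qed

lemma reg_rotate:
  assumes "submod N" "x \<in> jacobson_radical R" "set xs \<subseteq> jacobson_radical R"
  shows "reg N (x # xs) \<longleftrightarrow> reg N (xs @ [x])"
  using assms(1,3)
proof (induction xs arbitrary: N)
  case (Cons y xs)
  have y: "y \<in> jacobson_radical R" "set xs \<subseteq> jacobson_radical R" using Cons.prems(2) by simp_all
  have yc: "y \<in> carrier R" using y(1) by (simp add: jacobson_radical_def)
  have "reg N (x # y # xs) \<longleftrightarrow> reg N (y # x # xs)"
    using reg_swap[OF Cons.prems(1) assms(2) y(1)] reg_swap[OF Cons.prems(1) y(1) assms(2)] by blast
  then show ?case using Cons.IH[OF add_mult_submod[OF Cons.prems(1) yc] y(2)] by simp
qed simp

lemma Idl_mult_ext:
  assumes N: "submod N" and xs: "set xs \<subseteq> carrier R" and w: "w \<in> Idl (set xs)" "u \<in> carrier M"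
  shows "w \<odot>\<^bsub>M\<^esub> u \<in> ext N xs"
proof -
  have "set xs \<subseteq> colon (ext N xs) u" using ext_mult[OF N xs _ w(2)] xs by (auto simp: colon_def)
  then have "Idl (set xs) \<subseteq> colon (ext N xs) u"
    by (rule R.genideal_minimal[OF colon_ideal[OF ext_submod[OF N xs] w(2)]])
  then show ?thesis using w(1) by (auto simp: colon_def)
qed

text \<open>By induction \<open>(x + j) # xs\<close> is regular, and \<open>x + j\<close> is again
  in the Jacobson radical, so it may be rotated to the end. There \<open>j\<close> acts as zero
  because it lies in \<open>Idl (set xs)\<close>, so \<open>x\<close> is regular there too and
  rotates back to the front.\<close>

lemma reg_of_generators_jacobson:
  assumes "submod N" "set xs \<subseteq> jacobson_radical R"
    and "set zs \<subseteq> Idl (set xs)" "reg N zs" "length zs = length xs"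
  shows "reg N xs"
  using assms
proof (induction xs arbitrary: N zs)
  case (Cons x xs)
  note N = Cons.prems(1)
  have jac: "x \<in> jacobson_radical R" "set xs \<subseteq> jacobson_radical R" using Cons.prems(2) by simp_all
  then have c: "x \<in> carrier R" "set xs \<subseteq> carrier R" "set (x # xs) \<subseteq> carrier R"
    by (auto simp: jacobson_radical_def)
  obtain j ws where j: "j \<in> Idl (set xs)" "nzd N (x \<oplus> j)" "set ws \<subseteq> Idl (set xs)"
    "reg (add_mult N (x \<oplus> j)) ws" "length ws = length xs"
    using reg_first_generator[OF N c(3) Cons.prems(3,4)] Cons.prems(5) by auto
  have jc: "j \<in> carrier R" using ideal.Icarr[OF R.genideal_ideal[OF c(2)] j(1)] .
  then have yc: "x \<oplus> j \<in> carrier R" using c(1) by simp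
  have "j \<in> P" if P: "maximalideal P R" for P
  proof -
    have "set xs \<subseteq> P" using jac(2) P by (auto simp: jacobson_radical_def)
    then show ?thesis using R.genideal_minimal[OF maximalideal.axioms(1)[OF P]] j(1) by blast
  qed
  moreover have "x \<in> P" if "maximalideal P R" for P using jac(1) that by (simp add: jacobson_radical_def)
  ultimately have "x \<oplus> j \<in> P" if "maximalideal P R" for P
    using ideal_add[OF maximalideal.axioms(1)[OF that]] that by blast
  then have y: "x \<oplus> j \<in> jacobson_radical R" using yc by (simp add: jacobson_radical_def)
  have "reg N ((x \<oplus> j) # xs)"
    using Cons.IH[OF add_mult_submod[OF N yc] jac(2) j(3,4,5)] j(2) by simp
  then have r: "reg N xs" "nzd (ext N xs) (x \<oplus> j)" using reg_rotate[OF N y jac(2)] by simp_all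
  have "nzd (ext N xs) x"
    unfolding nzd_def
  proof (intro ballI impI)
    fix u assume u: "u \<in> carrier M" "x \<odot>\<^bsub>M\<^esub> u \<in> ext N xs"
    have "(x \<oplus> j) \<odot>\<^bsub>M\<^esub> u \<in> ext N xs"
      using submod_add[OF ext_submod[OF N c(2)] u(2) Idl_mult_ext[OF N c(2) j(1) u(1)]] c(1) jc u(1)
      by (simp add: smult_l_distr)
    then show "u \<in> ext N xs" using r(2) u(1) by (simp add: nzd_def)
  qed
  then have "reg N (xs @ [x])" using r(1) by simp
  then show ?case using reg_rotate[OF N jac] by simp
qed simp

section \<open>Regular sequences in terms of submodules\<close>

lemma mem_a_r_coset:
  assumes N: "submod N" and v: "v \<in> carrier M"
  shows "y \<in> N +>\<^bsub>M\<^esub> v \<longleftrightarrow> cong_mod N y v"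
proof
  assume "y \<in> N +>\<^bsub>M\<^esub> v"
  then obtain h where h: "h \<in> N" "y = h \<oplus>\<^bsub>M\<^esub> v" unfolding a_r_coset_def' by blast
  have "cong_mod N (h \<oplus>\<^bsub>M\<^esub> v) (\<zero>\<^bsub>M\<^esub> \<oplus>\<^bsub>M\<^esub> v)"
    using cong_mod_add[OF N _ cong_mod_refl[OF N v]] cong_mod_zero[OF N] h(1) by blast
  then show "cong_mod N y v" using h(2) v by simp
next
  assume y: "cong_mod N y v"
  then have "y = (y \<ominus>\<^bsub>M\<^esub> v) \<oplus>\<^bsub>M\<^esub> v"
    by (simp add: cong_mod_def a_minus_def M.a_assoc M.l_neg)
  moreover have "y \<ominus>\<^bsub>M\<^esub> v \<in> N" using y by (simp add: cong_mod_def)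
  ultimately show "y \<in> N +>\<^bsub>M\<^esub> v" unfolding a_r_coset_def' by blast
qed

lemma a_r_coset_eq_iff:
  assumes N: "submod N" and v: "u \<in> carrier M" "v \<in> carrier M"
  shows "N +>\<^bsub>M\<^esub> u = N +>\<^bsub>M\<^esub> v \<longleftrightarrow> cong_mod N u v"
proof
  assume "N +>\<^bsub>M\<^esub> u = N +>\<^bsub>M\<^esub> v"
  then show "cong_mod N u v" using mem_a_r_coset[OF N] v cong_mod_refl[OF N v(1)] by blast
next
  assume uv: "cong_mod N u v"
  have "cong_mod N y u \<longleftrightarrow> cong_mod N y v" for y
    using cong_mod_trans[OF N _ uv] cong_mod_trans[OF N _ cong_mod_sym[OF N uv]] by blast
  then show "N +>\<^bsub>M\<^esub> u = N +>\<^bsub>M\<^esub> v" using mem_a_r_coset[OF N] v by blast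
qed

lemma nonzerodivisor_on_quot:
  assumes N: "submod N" and r: "r \<in> carrier R"
  shows "nonzerodivisor_on (mod_quot M N) r \<longleftrightarrow> nzd N r"
proof -
  have zero: "N +>\<^bsub>M\<^esub> u = N \<longleftrightarrow> u \<in> N" if "u \<in> carrier M" for u
  proof -
    have "N +>\<^bsub>M\<^esub> \<zero>\<^bsub>M\<^esub> = N" using mem_a_r_coset[OF N M.zero_closed] cong_mod_zero[OF N] by blast
    then show ?thesis using a_r_coset_eq_iff[OF N that M.zero_closed] cong_mod_zero[OF N] by simp
  qed
  \<comment> \<open>Scalar multiplication in \<open>mod_quot\<close> is a union over all
    representatives of a coset; it collapses to one coset as all of them give the same
    result.\<close>
  have smult: "(\<Union>x\<in>N +>\<^bsub>M\<^esub> u. N +>\<^bsub>M\<^esub> (r \<odot>\<^bsub>M\<^esub> x)) = N +>\<^bsub>M\<^esub> (r \<odot>\<^bsub>M\<^esub> u)" if u: "u \<in> carrier M" for u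
  proof -
    have "N +>\<^bsub>M\<^esub> (r \<odot>\<^bsub>M\<^esub> x) = N +>\<^bsub>M\<^esub> (r \<odot>\<^bsub>M\<^esub> u)" if "x \<in> N +>\<^bsub>M\<^esub> u" for x
    proof -
      have x: "cong_mod N x u" using that mem_a_r_coset[OF N u] by blast
      then have "x \<in> carrier M" by (simp add: cong_mod_def)
      then show ?thesis
        using a_r_coset_eq_iff[OF N smult_closed[OF r] smult_closed[OF r u]] cong_mod_smult[OF N x r] by blast
    qed
    moreover have "u \<in> N +>\<^bsub>M\<^esub> u" using mem_a_r_coset[OF N u] cong_mod_refl[OF N u] by blast
    ultimately show ?thesis by blast
  qed
  have "nonzerodivisor_on (mod_quot M N) r \<longleftrightarrow>
    (\<forall>u\<in>carrier M. (\<Union>x\<in>N +>\<^bsub>M\<^esub> u. N +>\<^bsub>M\<^esub> (r \<odot>\<^bsub>M\<^esub> x)) = N \<longrightarrow> N +>\<^bsub>M\<^esub> u = N)"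
    unfolding nonzerodivisor_on_def mod_quot_def by (auto simp: A_RCOSETS_def')
  also have "\<dots> \<longleftrightarrow> nzd N r" unfolding nzd_def using smult zero r by simp
  finally show ?thesis .
qed

lemma ideal_smult_least:
  assumes "submod L" "\<And>r x. r \<in> J \<Longrightarrow> x \<in> carrier M \<Longrightarrow> r \<odot>\<^bsub>M\<^esub> x \<in> L"
  shows "ideal_smult R J M \<subseteq> L"
  unfolding ideal_smult_def by (rule mod_span_least[OF assms(1)]) (use assms(2) in blast)

lemma mod_span_submod:
  assumes "S \<subseteq> carrier M" shows "submod (mod_span R M S)"
proof (rule submoduleI)
  show "mod_span R M S \<subseteq> carrier M" by (rule mod_span_least[OF carrier_is_submodule assms])
qed (auto simp: mod_span_def submod_zero submod_uminus submod_add submod_smult)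

lemma ideal_smult_submod: "J \<subseteq> carrier R \<Longrightarrow> submod (ideal_smult R J M)"
  unfolding ideal_smult_def by (rule mod_span_submod) blast

lemma ideal_smult_mult: "r \<in> J \<Longrightarrow> x \<in> carrier M \<Longrightarrow> r \<odot>\<^bsub>M\<^esub> x \<in> ideal_smult R J M"
  unfolding ideal_smult_def by (rule subsetD[OF mod_span_superset]) blast

lemma ext_zero_subset_ideal_smult:
  assumes "J \<subseteq> carrier R" "set xs \<subseteq> J"
  shows "ext {\<zero>\<^bsub>M\<^esub>} xs \<subseteq> ideal_smult R J M"
  using assms ideal_smult_mult submod_zero[OF ideal_smult_submod[OF assms(1)]]
  by (intro ext_least[OF zero_submod _ ideal_smult_submod]) auto

lemma ideal_smult_Idl:
  assumes "set xs \<subseteq> carrier R"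
  shows "ideal_smult R (Idl (set xs)) M = ext {\<zero>\<^bsub>M\<^esub>} xs"
proof
  show "ideal_smult R (Idl (set xs)) M \<subseteq> ext {\<zero>\<^bsub>M\<^esub>} xs"
    by (intro ideal_smult_least ext_submod zero_submod assms Idl_mult_ext)
  have "Idl (set xs) \<subseteq> carrier R" using ideal.Icarr[OF R.genideal_ideal[OF assms]] by blast
  then show "ext {\<zero>\<^bsub>M\<^esub>} xs \<subseteq> ideal_smult R (Idl (set xs)) M"
    by (rule ext_zero_subset_ideal_smult[OF _ R.genideal_self[OF assms]])
qed

lemma reg_iff_nth: "reg N xs \<longleftrightarrow> (\<forall>i<length xs. nzd (ext N (take i xs)) (xs ! i))"
  by (induction xs arbitrary: N) (simp_all add: All_less_Suc2)

lemma regular_seq_iff: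
  "regular_seq R M xs \<longleftrightarrow> set xs \<subseteq> carrier R \<and> reg {\<zero>\<^bsub>M\<^esub>} xs \<and> ext {\<zero>\<^bsub>M\<^esub>} xs \<noteq> carrier M"
proof (cases "set xs \<subseteq> carrier R")
  case True
  have "nonzerodivisor_on (mod_quot M (ideal_smult R (Idl (set (take i xs))) M)) (xs ! i) \<longleftrightarrow>
    nzd (ext {\<zero>\<^bsub>M\<^esub>} (take i xs)) (xs ! i)" if "i < length xs" for i
  proof -
    have t: "set (take i xs) \<subseteq> carrier R" using True set_take_subset[of i xs] by blast
    have "xs ! i \<in> carrier R" using True nth_mem[OF that] by blast
    then show ?thesis
      unfolding ideal_smult_Idl[OF t] by (rule nonzerodivisor_on_quot[OF ext_submod[OF zero_submod t]])
  qed
  then show ?thesis unfolding regular_seq_def reg_iff_nth ideal_smult_Idl[OF True] using True by auto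
qed (simp add: regular_seq_def)

text \<open>For entries in \<open>I\<close> the submodule \<open>ext {0} xs\<close> lies in the
  proper submodule \<open>IM\<close>, so the properness clause of \<open>regular_seq\<close> is
  automatic.\<close>

lemma regular_seq_in_ideal_iff:
  assumes "ideal I R" "carrier M \<noteq> ideal_smult R I M" "set xs \<subseteq> I"
  shows "regular_seq R M xs \<longleftrightarrow> reg {\<zero>\<^bsub>M\<^esub>} xs"
proof -
  have I: "I \<subseteq> carrier R" using ideal.Icarr[OF assms(1)] by blast
  have "ext {\<zero>\<^bsub>M\<^esub>} xs \<noteq> carrier M"
    using ext_zero_subset_ideal_smult[OF I assms(3)] submod_subset[OF ideal_smult_submod[OF I]] assms(2) by blast
  then show ?thesis using regular_seq_iff assms(3) I by blast
qed

section \<open>Maximal regular sequences and the grade\<close>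

lemma maximal_regular_seq_iff:
  assumes "ideal I R" "carrier M \<noteq> ideal_smult R I M"
  shows "maximal_regular_seq R I M xs \<longleftrightarrow>
    set xs \<subseteq> I \<and> reg {\<zero>\<^bsub>M\<^esub>} xs \<and> (\<forall>y\<in>I. \<not> nzd (ext {\<zero>\<^bsub>M\<^esub>} xs) y)"
proof (cases "set xs \<subseteq> I")
  case True
  then have "regular_seq R M (xs @ [y]) \<longleftrightarrow> reg {\<zero>\<^bsub>M\<^esub>} xs \<and> nzd (ext {\<zero>\<^bsub>M\<^esub>} xs) y" if "y \<in> I" for y
    using regular_seq_in_ideal_iff[OF assms, of "xs @ [y]"] that by simp
  then show ?thesis
    unfolding maximal_regular_seq_def using regular_seq_in_ideal_iff[OF assms True] by blast
qed (simp add: maximal_regular_seq_def)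

text \<open>Extending a regular sequence strictly enlarges the ideal it generates: a nonzerodivisor
  on \<open>M/(xs)M\<close> that already lies in \<open>(xs)\<close> would force
  \<open>M = (xs)M\<close>. Hence a maximal such ideal comes from a maximal sequence.\<close>

lemma exists_maximal_regular_seq:
  assumes "ideal I R" "carrier M \<noteq> ideal_smult R I M"
  shows "\<exists>xs. maximal_regular_seq R I M xs"
proof -
  have I: "I \<subseteq> carrier R" using ideal.Icarr[OF assms(1)] by blast
  let ?F = "(\<lambda>xs. Idl (set xs)) ` {xs. set xs \<subseteq> I \<and> reg {\<zero>\<^bsub>M\<^esub>} xs}"
  have "\<exists>J\<in>?F. \<forall>K\<in>?F. J \<subseteq> K \<longrightarrow> K = J"
  proof (rule N.maximal_ideal_in_family)
    show "?F \<noteq> {}" by (auto intro: exI[of _ "[]"])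
    show "ideal J R" if "J \<in> ?F" for J using that I R.genideal_ideal by blast
  qed
  then obtain J where J: "J \<in> ?F" "\<forall>K\<in>?F. J \<subseteq> K \<longrightarrow> K = J" by (rule bexE)
  then obtain xs where xs: "J = Idl (set xs)" "set xs \<subseteq> I" "reg {\<zero>\<^bsub>M\<^esub>} xs" by blast
  have xsR: "set xs \<subseteq> carrier R" using xs(2) I by blast
  have "\<not> nzd (ext {\<zero>\<^bsub>M\<^esub>} xs) y" if y: "y \<in> I" for y
  proof
    assume n: "nzd (ext {\<zero>\<^bsub>M\<^esub>} xs) y"
    have yR: "insert y (set xs) \<subseteq> carrier R" using y I xsR by blast
    have "Idl (set (xs @ [y])) \<in> ?F" using xs n y by (intro imageI) simp
    moreover have "J \<subseteq> Idl (set (xs @ [y]))" using Idl_insert_subset(3)[OF refl yR] xs(1) by simp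
    ultimately have "Idl (set (xs @ [y])) = J" using J(2) by blast
    then have "y \<in> Idl (set xs)" using Idl_insert_subset(2)[OF refl yR] xs(1) by simp
    then have "carrier M \<subseteq> ext {\<zero>\<^bsub>M\<^esub>} xs"
      using n Idl_mult_ext[OF zero_submod xsR] unfolding nzd_def by blast
    then show False
      using regular_seq_in_ideal_iff[OF assms xs(2)] xs(3) regular_seq_iff
        submod_subset[OF ext_submod[OF zero_submod xsR]] by blast
  qed
  then have "maximal_regular_seq R I M xs" using maximal_regular_seq_iff[OF assms] xs by blast
  then show ?thesis by blast
qed

text \<open>Maximality of \<open>xs\<close> means that \<open>I\<close> kills a class modulo
  \<open>ext {0} xs\<close>. By Rees' theorem it does so modulo any regular sequence of that length
  in \<open>I\<close>, which then has no next entry.\<close>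

lemma reg_length_le:
  assumes I: "ideal I R" "carrier M \<noteq> ideal_smult R I M"
    and xs: "maximal_regular_seq R I M xs" and ys: "set ys \<subseteq> I" "reg {\<zero>\<^bsub>M\<^esub>} ys"
  shows "length ys \<le> length xs"
proof (rule ccontr)
  assume "\<not> length ys \<le> length xs"
  then have lt: "length xs < length ys" by simp
  have IR: "I \<subseteq> carrier R" using ideal.Icarr[OF I(1)] by blast
  have xs': "set xs \<subseteq> I" "reg {\<zero>\<^bsub>M\<^esub>} xs" "\<And>y. y \<in> I \<Longrightarrow> \<not> nzd (ext {\<zero>\<^bsub>M\<^esub>} xs) y"
    using xs maximal_regular_seq_iff[OF I] by blast+
  let ?E = "ext {\<zero>\<^bsub>M\<^esub>} xs"
  have E: "submod ?E" by (rule ext_submod[OF zero_submod subset_trans[OF xs'(1) IR]])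
  have k: "kills I ?E"
    using exists_nzd_in_ideal[of "{?E}" I] I(1) E xs'(3) by auto
  let ?ps = "take (length xs) ys" and ?y = "ys ! length xs"
  have "ys = ?ps @ ?y # drop (Suc (length xs)) ys" using id_take_nth_drop[OF lt] .
  then have "reg {\<zero>\<^bsub>M\<^esub>} (?ps @ ?y # drop (Suc (length xs)) ys)" using ys(2) by simp
  then have ps: "reg {\<zero>\<^bsub>M\<^esub>} ?ps" "nzd (ext {\<zero>\<^bsub>M\<^esub>} ?ps) ?y" by simp_all
  have "set ?ps \<subseteq> I" "?y \<in> I" using ys(1) nth_mem[OF lt] set_take_subset[of "length xs" ys] by auto
  moreover from this(1) have "kills I (ext {\<zero>\<^bsub>M\<^esub>} ?ps)"
    using kills_ext_transfer[OF zero_submod I(1) xs'(1) _ xs'(2) ps(1) _ k] lt by simp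
  ultimately show False using nzd_not_kills[OF ps(2)] by blast
qed

lemma grade_eq:
  assumes "ideal I R" "carrier M \<noteq> ideal_smult R I M" "maximal_regular_seq R I M xs"
  shows "grade R I M = length xs"
  unfolding grade_def
proof (rule the_equality)
  have le: "length ys \<le> length zs"
    if "maximal_regular_seq R I M zs" "maximal_regular_seq R I M ys" for ys zs
    using reg_length_le[OF assms(1,2) that(1)] that(2) maximal_regular_seq_iff[OF assms(1,2)] by blast
  have "length ys = length xs" if "maximal_regular_seq R I M ys" for ys
    using le[OF that assms(3)] le[OF assms(3) that] by simp
  then show "(\<exists>xs. maximal_regular_seq R I M xs) \<and>
      (\<forall>ys. maximal_regular_seq R I M ys \<longrightarrow> length ys = length xs)"
    using assms(3) by blast
  show "n = length xs" if "(\<exists>xs. maximal_regular_seq R I M xs) \<and>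
      (\<forall>xs. maximal_regular_seq R I M xs \<longrightarrow> length xs = n)" for n
    using that assms(3) by blast
qed

section \<open>Radicals and relative systems of parameters\<close>

lemma Ann_ideal: "ideal (Ann R M) R"
proof -
  have "Ann R M = carrier R \<inter> (\<Inter>u\<in>carrier M. colon {\<zero>\<^bsub>M\<^esub>} u)" by (auto simp: Ann_def colon_def)
  \<comment> \<open>Over an empty index set the intersection would be the whole type rather than a
    subset of \<open>carrier R\<close>.\<close>
  moreover have "carrier M \<noteq> {}" by blast
  ultimately have eq: "Ann R M = (\<Inter>u\<in>carrier M. colon {\<zero>\<^bsub>M\<^esub>} u)" by (auto simp: colon_def)
  have "ideal (\<Inter> (colon {\<zero>\<^bsub>M\<^esub>} ` carrier M)) R"
    by (rule R.i_Intersect) (use colon_ideal[OF zero_submod] in auto)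
  then show ?thesis using eq by simp
qed

text \<open>Some power of \<open>y\<close> is the sum of an element of \<open>Idl (set xs)\<close>
  and one of the annihilator, and the latter acts as zero on \<open>M\<close>.\<close>

lemma same_radical_power:
  assumes I: "ideal I R" and xs: "set xs \<subseteq> carrier R" "same_radical R I M xs" and y: "y \<in> I"
  shows "\<exists>n w. w \<in> Idl (set xs) \<and> (\<forall>u\<in>carrier M. y [^] (n::nat) \<odot>\<^bsub>M\<^esub> u = w \<odot>\<^bsub>M\<^esub> u)"
proof -
  have "y \<in> Rad R (I <+>\<^bsub>R\<^esub> Ann R M)"
    using set_add_superset(1)[OF I Ann_ideal] subset_Rad[OF R.add_ideals[OF I Ann_ideal]] y by blast
  then have "y \<in> Rad R (Idl (set xs) <+>\<^bsub>R\<^esub> Ann R M)" using xs(2) by (simp add: same_radical_def)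
  then obtain n where "y [^] (n::nat) \<in> Idl (set xs) <+>\<^bsub>R\<^esub> Ann R M" by (auto simp: Rad_def)
  then obtain w b where wb: "w \<in> Idl (set xs)" "b \<in> Ann R M" "y [^] n = w \<oplus> b"
    unfolding set_add_def' by blast
  have wc: "w \<in> carrier R" using ideal.Icarr[OF R.genideal_ideal[OF xs(1)] wb(1)] .
  have "y [^] n \<odot>\<^bsub>M\<^esub> u = w \<odot>\<^bsub>M\<^esub> u" if "u \<in> carrier M" for u
    using wb(2,3) wc that by (simp add: Ann_def smult_l_distr)
  then show ?thesis using wb(1) by blast
qed

lemma nzd_power:
  assumes "nzd L y" "y \<in> carrier R" "u \<in> carrier M" "y [^] (n::nat) \<odot>\<^bsub>M\<^esub> u \<in> L"
  shows "u \<in> L"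
  using assms(3,4)
proof (induction n arbitrary: u)
  case (Suc n)
  have "y [^] n \<odot>\<^bsub>M\<^esub> (y \<odot>\<^bsub>M\<^esub> u) \<in> L" using Suc.prems assms(2) by (simp add: smult_assoc1)
  then have "y \<odot>\<^bsub>M\<^esub> u \<in> L" using Suc.IH Suc.prems(1) assms(2) by simp
  then show ?case using assms(1) Suc.prems(1) by (simp add: nzd_def)
qed simp

lemma same_radical_not_nzd:
  assumes I: "ideal I R" and xs: "set xs \<subseteq> carrier R" "same_radical R I M xs" and y: "y \<in> I"
    and u: "u \<in> carrier M" "u \<notin> L" "\<And>w. w \<in> Idl (set xs) \<Longrightarrow> w \<odot>\<^bsub>M\<^esub> u \<in> L"
  shows "\<not> nzd L y"
proof
  assume n: "nzd L y"
  obtain n w where w: "w \<in> Idl (set xs)" "\<forall>u\<in>carrier M. y [^] (n::nat) \<odot>\<^bsub>M\<^esub> u = w \<odot>\<^bsub>M\<^esub> u"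
    using same_radical_power[OF I xs y] by blast
  then have "y [^] n \<odot>\<^bsub>M\<^esub> u \<in> L" using u(1,3) by simp
  then have "u \<in> L" by (rule nzd_power[OF n ideal.Icarr[OF I y] u(1)])
  then show False using u(2) by simp
qed

text \<open>A class killed by \<open>Idl (set xs)\<close> need not be killed by \<open>I\<close>,
  only by powers of its elements. That already makes every element of \<open>I\<close> a zero
  divisor on \<open>M/L\<close>, and prime avoidance then produces a possibly different class killed
  by all of \<open>I\<close>.\<close>

lemma same_radical_kills:
  assumes I: "ideal I R" and xs: "set xs \<subseteq> carrier R" "same_radical R I M xs"
    and L: "submod L" "kills (Idl (set xs)) L"
  shows "kills I L"
proof (rule ccontr)
  assume "\<not> kills I L"
  then obtain y where y: "y \<in> I" "nzd L y" using exists_nzd_in_ideal[of "{L}" I] I L(1) by auto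
  obtain u where "u \<in> carrier M" "u \<notin> L" "\<And>w. w \<in> Idl (set xs) \<Longrightarrow> w \<odot>\<^bsub>M\<^esub> u \<in> L"
    using L(2) unfolding kills_def by blast
  then show False using same_radical_not_nzd[OF I xs y(1)] y(2) by blast
qed

lemma same_radical_reg:
  assumes I: "ideal I R" and xs: "set xs \<subseteq> I" "same_radical R I M xs"
    and zs: "set zs \<subseteq> I" "reg {\<zero>\<^bsub>M\<^esub>} zs"
  shows "\<exists>ws. set ws \<subseteq> Idl (set xs) \<and> reg {\<zero>\<^bsub>M\<^esub>} ws \<and> length ws = length zs"
proof -
  have xsR: "set xs \<subseteq> carrier R" using xs(1) ideal.Icarr[OF I] by blast
  have "\<exists>ys'. set ys' \<subseteq> Idl (set xs) \<and> reg (ext {\<zero>\<^bsub>M\<^esub>} []) ys' \<and>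
      length ([]::'a list) + length ys' = length zs"
    by (rule reg_extend[OF zero_submod I R.genideal_ideal[OF xsR] R.genideal_minimal[OF I xs(1)] zs
          same_radical_kills[OF I xsR xs(2)]]) simp_all
  then show ?thesis by simp
qed

text \<open>Any class outside \<open>ext {0} xs\<close> is killed modulo it by the ideal of
  \<open>xs\<close>, hence by a power of each \<open>y\<close> in \<open>I\<close>; no such
  \<open>y\<close> can continue the sequence.\<close>

lemma same_radical_maximal:
  assumes I: "ideal I R" "carrier M \<noteq> ideal_smult R I M"
    and xs: "set xs \<subseteq> I" "same_radical R I M xs" "reg {\<zero>\<^bsub>M\<^esub>} xs"
  shows "maximal_regular_seq R I M xs"
proof -
  have xsR: "set xs \<subseteq> carrier R" using xs(1) ideal.Icarr[OF I(1)] by blast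
  have "ext {\<zero>\<^bsub>M\<^esub>} xs \<noteq> carrier M"
    using regular_seq_in_ideal_iff[OF I xs(1)] xs(3) regular_seq_iff by blast
  then obtain u where u: "u \<in> carrier M" "u \<notin> ext {\<zero>\<^bsub>M\<^esub>} xs"
    using submod_subset[OF ext_submod[OF zero_submod xsR]] by blast
  have "\<not> nzd (ext {\<zero>\<^bsub>M\<^esub>} xs) y" if "y \<in> I" for y
    by (rule same_radical_not_nzd[OF I(1) xsR xs(2) that u Idl_mult_ext[OF zero_submod xsR _ u(1)]])
  then show ?thesis using maximal_regular_seq_iff[OF I] xs by blast
qed

text \<open>The arithmetic rank admits elements anywhere in \<open>R\<close>, whereas a relative
  system of parameters must lie in \<open>I\<close>. Each \<open>x\<close> is replaced by the
  \<open>I\<close>-component of a power of \<open>x\<close> lying in the sum of \<open>I\<close> and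
  the annihilator.\<close>

lemma same_radical_in_ideal:
  assumes I: "ideal I R" and xs: "set xs \<subseteq> carrier R" "same_radical R I M xs"
  shows "\<exists>ys. set ys \<subseteq> I \<and> length ys = length xs \<and> same_radical R I M ys"
proof -
  note A = Ann_ideal
  note J = R.genideal_ideal[OF xs(1)]
  have "\<exists>a. a \<in> I \<and> (\<exists>n. \<exists>b\<in>Ann R M. x [^] (n::nat) = a \<oplus> b)" if "x \<in> set xs" for x
  proof -
    have "x \<in> Rad R (Idl (set xs) <+>\<^bsub>R\<^esub> Ann R M)"
      using that R.genideal_self[OF xs(1)] set_add_superset(1)[OF J A] subset_Rad[OF R.add_ideals[OF J A]]
      by blast
    then have "x \<in> Rad R (I <+>\<^bsub>R\<^esub> Ann R M)" using xs(2) by (simp add: same_radical_def)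
    then obtain n where "x [^] (n::nat) \<in> I <+>\<^bsub>R\<^esub> Ann R M" by (auto simp: Rad_def)
    then show ?thesis unfolding set_add_def' by blast
  qed
  then obtain f where f: "\<And>x. x \<in> set xs \<Longrightarrow> f x \<in> I \<and> (\<exists>n. \<exists>b\<in>Ann R M. x [^] (n::nat) = f x \<oplus> b)"
    by metis
  define ys where "ys = map f xs"
  have ysI: "set ys \<subseteq> I" using f by (auto simp: ys_def)
  then have ysR: "set ys \<subseteq> carrier R" using ideal.Icarr[OF I] by blast
  note Y = R.genideal_ideal[OF ysR]
  note IA = R.add_ideals[OF I A] and JA = R.add_ideals[OF J A] and YA = R.add_ideals[OF Y A]
  have "Idl (set ys) \<subseteq> I" by (rule R.genideal_minimal[OF I ysI])
  then have "Idl (set ys) <+>\<^bsub>R\<^esub> Ann R M \<subseteq> I <+>\<^bsub>R\<^esub> Ann R M" unfolding set_add_def' by blast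
  then have 1: "Rad R (Idl (set ys) <+>\<^bsub>R\<^esub> Ann R M) \<subseteq> Rad R (I <+>\<^bsub>R\<^esub> Ann R M)" by (rule Rad_mono)
  have "x \<in> Rad R (Idl (set ys) <+>\<^bsub>R\<^esub> Ann R M)" if x: "x \<in> set xs" for x
  proof -
    obtain n b where n: "b \<in> Ann R M" "x [^] (n::nat) = f x \<oplus> b" using f[OF x] by blast
    have "f x \<in> Idl (set ys)" using R.genideal_self[OF ysR] x by (auto simp: ys_def)
    then have "x [^] n \<in> Idl (set ys) <+>\<^bsub>R\<^esub> Ann R M" using n unfolding set_add_def' by blast
    then show ?thesis using x xs(1) by (auto simp: Rad_def)
  qed
  then have "Idl (set xs) \<subseteq> Rad R (Idl (set ys) <+>\<^bsub>R\<^esub> Ann R M)"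
    by (intro R.genideal_minimal[OF Rad_ideal[OF YA]]) blast
  moreover have "Ann R M \<subseteq> Rad R (Idl (set ys) <+>\<^bsub>R\<^esub> Ann R M)"
    using set_add_superset(2)[OF Y A] subset_Rad[OF YA] by blast
  ultimately have "Idl (set xs) <+>\<^bsub>R\<^esub> Ann R M \<subseteq> Rad R (Idl (set ys) <+>\<^bsub>R\<^esub> Ann R M)"
    by (rule set_add_least[OF Rad_ideal[OF YA]])
  then have "Rad R (I <+>\<^bsub>R\<^esub> Ann R M) \<subseteq> Rad R (Idl (set ys) <+>\<^bsub>R\<^esub> Ann R M)"
    using Rad_subset_iff[OF JA YA] xs(2) by (simp add: same_radical_def)
  then have "same_radical R I M ys" unfolding same_radical_def using 1 by blast
  then show ?thesis using ysI by (intro exI[of _ ys]) (simp add: ys_def)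
qed

text \<open>Finitely many generators of \<open>I\<close> qualify, so the infimum is over a nonempty
  set of natural numbers and is attained. In the theorem this makes \<open>cd\<close> a natural
  number.\<close>

lemma ara_attained:
  assumes I: "ideal I R"
  shows "\<exists>xs. set xs \<subseteq> carrier R \<and> same_radical R I M xs \<and> ara R I M = ereal (real (length xs))"
proof -
  define S where "S = {xs. set xs \<subseteq> carrier R \<and> same_radical R I M xs}"
  obtain A where A: "A \<subseteq> carrier R" "finite A" "I = Idl A" using N.finetely_gen[OF I] by blast
  obtain zs where "set zs = A" using finite_list[OF A(2)] by blast
  then have "zs \<in> S" using A by (simp add: S_def same_radical_def)
  then obtain xs where xs: "xs \<in> S" "\<And>ys. ys \<in> S \<Longrightarrow> length xs \<le> length ys"
    using ex_has_least_nat[of "\<lambda>xs. xs \<in> S" zs length] by blast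
  have "ara R I M = Inf ((\<lambda>xs. ereal (real (length xs))) ` S)"
    unfolding ara_def S_def by (rule arg_cong[of _ _ Inf]) blast
  also have "\<dots> = ereal (real (length xs))"
    by (rule cInf_eq_minimum) (use xs in auto)
  finally show ?thesis using xs(1) by (auto simp: S_def)
qed

end

section \<open>The equivalences\<close>

theorem theorem3p3:
  fixes R :: "('a, 'r) ring_scheme" and M :: "('a, 'b, 's) module_scheme" and I :: "'a set"
  assumes "cring R" and "noetherian_ring R"
    and "module R M" and "fin_gen R M"
    and "ideal I R" and "carrier M \<noteq> ideal_smult R I M"
    and "ara R I M = cd R I M"
  shows "(rel_cohen_macaulay R I M \<longleftrightarrow> (\<exists>xs. rel_sop R I M xs \<and> regular_seq R M xs)) \<and>
    (I \<subseteq> jacobson_radical R \<longrightarrow>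
      (rel_cohen_macaulay R I M \<longleftrightarrow> (\<forall>xs. rel_sop R I M xs \<longrightarrow> regular_seq R M xs)) \<and>
      ((\<forall>xs. rel_sop R I M xs \<longrightarrow> regular_seq R M xs) \<longleftrightarrow>
       (\<exists>xs. rel_sop R I M xs \<and> regular_seq R M xs)))"
proof -
  interpret fg_noetherian_module R M
    by (intro fg_noetherian_module.intro fg_noetherian_module_axioms.intro assms(2-4))
  note I = assms(5,6)
  obtain ys where ys: "set ys \<subseteq> carrier R" "same_radical R I M ys" "ara R I M = ereal (real (length ys))"
    using ara_attained[OF I(1)] by blast
  obtain xs where xs: "set xs \<subseteq> I" "length xs = length ys" "same_radical R I M xs"
    using same_radical_in_ideal[OF I(1) ys(1,2)] by blast
  \<comment> \<open>A shortest sequence, moved into \<open>I\<close>, has length exactly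
    \<open>cd\<close> because \<open>ara = cd\<close>.\<close>
  have sop: "rel_sop R I M xs" using xs ys(3) assms(7) by (simp add: rel_sop_def)
  have reg_of_cm: "\<exists>ws. set ws \<subseteq> Idl\<^bsub>R\<^esub> (set xs) \<and> reg {\<zero>\<^bsub>M\<^esub>} ws \<and> length ws = length xs"
    if cm: "rel_cohen_macaulay R I M" and s: "rel_sop R I M xs" for xs
  proof -
    obtain zs where zs: "maximal_regular_seq R I M zs" using exists_maximal_regular_seq[OF I] by blast
    have "ereal (real (length zs)) = ereal (real (length xs))"
      using cm s grade_eq[OF I zs] by (simp add: rel_cohen_macaulay_def rel_sop_def)
    then have "length zs = length xs" by simp
    then show ?thesis
      using same_radical_reg[OF I(1), of xs zs] s zs maximal_regular_seq_iff[OF I]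
      by (simp add: rel_sop_def)
  qed
  have cm_of_reg: "rel_cohen_macaulay R I M" if s: "rel_sop R I M xs" "regular_seq R M xs" for xs
  proof -
    have "maximal_regular_seq R I M xs"
      using same_radical_maximal[OF I] regular_seq_in_ideal_iff[OF I] s by (simp add: rel_sop_def)
    from grade_eq[OF I this] show ?thesis using s(1) I(2) by (simp add: rel_cohen_macaulay_def rel_sop_def)
  qed
  have IR: "I \<subseteq> carrier R" using ideal.Icarr[OF I(1)] by blast
  \<comment> \<open>The elements of \<open>xs\<close> themselves need not be regular;
    \<open>reg_generators\<close> trades them for equally many generators of the same ideal, which
    keeps the radical condition.\<close>
  have "\<exists>ys. rel_sop R I M ys \<and> regular_seq R M ys" if cm: "rel_cohen_macaulay R I M"
  proof -
    have xsR: "set xs \<subseteq> carrier R" using xs(1) IR by blast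
    obtain ws where "set ws \<subseteq> Idl\<^bsub>R\<^esub> (set xs)" "reg {\<zero>\<^bsub>M\<^esub>} ws" "length ws = length xs"
      using reg_of_cm[OF cm sop] by blast
    then obtain vs where vs: "set vs \<subseteq> carrier R" "reg {\<zero>\<^bsub>M\<^esub>} vs" "length vs = length xs"
      "Idl\<^bsub>R\<^esub> (set vs) = Idl\<^bsub>R\<^esub> (set xs)"
      using reg_generators[OF zero_submod xsR] by blast
    have vsI: "set vs \<subseteq> I" using R.genideal_self[OF vs(1)] R.genideal_minimal[OF I(1) xs(1)] vs(4) by blast
    have "rel_sop R I M vs" using sop vsI vs(3,4) by (simp add: rel_sop_def same_radical_def)
    moreover have "regular_seq R M vs" using regular_seq_in_ideal_iff[OF I vsI] vs(2) by blast
    ultimately show ?thesis by blast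
  qed
  moreover have "regular_seq R M xs"
    if jac: "I \<subseteq> jacobson_radical R" and cm: "rel_cohen_macaulay R I M" and s: "rel_sop R I M xs" for xs
  proof -
    have xsI: "set xs \<subseteq> I" using s by (simp add: rel_sop_def)
    obtain ws where "set ws \<subseteq> Idl\<^bsub>R\<^esub> (set xs)" "reg {\<zero>\<^bsub>M\<^esub>} ws" "length ws = length xs"
      using reg_of_cm[OF cm s] by blast
    then have "reg {\<zero>\<^bsub>M\<^esub>} xs"
      using reg_of_generators_jacobson[OF zero_submod subset_trans[OF xsI jac]] by blast
    then show ?thesis using regular_seq_in_ideal_iff[OF I xsI] by blast
  qed
  \<comment> \<open>Condition (ii) yields (iii) by applying it to the \<open>xs\<close> of
    \<open>sop\<close>.\<close>
  ultimately show ?thesis using cm_of_reg sop by blast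
qed

end
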